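(* Let $\mathbb M$ be an $\mathcal R$-module and assume there exists an epimorphism $\pi\colon \bigoplus_{l\in L}\mathcal W_l^*\to \mathbb M$, where $\{W_l\}_{l\in L}$ is a set of $R$-modules. The following statements are equivalent: (1) $\mathbb M$ is a left-exact ML $\mathcal R$-module. (2) For every $R$-module $N$, every morphism of $\mathcal R$-modules $\mathcal N^*\to\mathbb M$ factors through a submodule scheme of $\mathbb M$. (3) $\mathbb M$ is equal to a direct limit of submodule schemes of $\mathbb M$.
   Context: $R$ is an associative ring with unit; "$R$-module" means left $R$-module. An $\mathcal R$-module is a covariant additive functor from the category of left $R$-modules to the category of abelian groups; morphisms of $\mathcal R$-modules are natural transformations. Monomorphisms, epimorphisms, submodules, kernels, images, direct sums and direct limits of $\mathcal R$-modules are taken objectwise. For an $R$-module $N$, the module scheme $\mathcal N^*$ associated with $N$ is the $\mathcal R$-module $\mathcal N^*=\mathrm{Hom}_R(N,-)$. A submodule scheme of $\mathbb M$ is an $\mathcal R$-submodule of $\mathbb M$ isomorphic to a module scheme. Direct limits are over upward directed sets; "$\mathbb M$ is equal to a direct limit of submodule schemes" means that $\mathbb M$ is the union of a family (indexed by a set) of submodule schemes of $\mathbb M$ that is upward directed by inclusion. $\mathbb M$ is left-exact if it is a left-exact functor. $\mathbb M$ is an ML $\mathcal R$-module if the natural morphism $\mathbb M(\prod_{i\in I}N_i)\to\prod_{i\in I}\mathbb M(N_i)$ is injective for every set $\{N_i\}_{i\in I}$ of $R$-modules. *)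

theory Defs
  imports "HOL-Algebra.Module" "HOL-Algebra.Product_Groups"
begin

unbundle cardinal_syntax

section \<open>Small sets\<close>

text \<open>
  The category of all left modules over a ring has a proper class of objects, so it is taken
  relative to a universe: a type whose cardinality is a regular strong limit. The sets of the
  universe are the sets of cardinality below that of the type; they play the role of the sets,
  and all other collections that of the classes. The two axioms are the closure of a Grothendieck
  universe under power sets and under unions of small families. They force the type to be
  infinite; it is not required to be uncountable (for \<open>nat\<close>, the small sets are the finite ones).
\<close>

class universe =
  assumes small_Pow: "|A :: 'a set| <o |UNIV :: 'a set| \<Longrightarrow> |Pow A| <o |UNIV :: 'a set|"
    and small_UN: "|I :: 'a set| <o |UNIV :: 'a set| \<Longrightarrow>
      (\<And>i. i \<in> I \<Longrightarrow> |F i :: 'a set| <o |UNIV :: 'a set| ) \<Longrightarrow> |\<Union>i\<in>I. F i| <o |UNIV :: 'a set|"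

definition small :: "'u::universe set \<Rightarrow> bool"
  where "small A \<longleftrightarrow> |A| <o |UNIV :: 'u set|"


section \<open>Left modules over a ring that need not be commutative\<close>

text \<open>The locale \<open>module\<close> of HOL-Algebra with \<open>cring\<close> replaced by \<open>ring\<close>.\<close>

locale left_module = R?: ring R + M?: abelian_group M
  for R :: "('r, 'd) ring_scheme" (structure) and M :: "('r, 'u, 'c) module_scheme" (structure) +
  assumes smult_closed [simp, intro]:
      "\<lbrakk>a \<in> carrier R; x \<in> carrier M\<rbrakk> \<Longrightarrow> a \<odot>\<^bsub>M\<^esub> x \<in> carrier M"
    and smult_l_distr:
      "\<lbrakk>a \<in> carrier R; b \<in> carrier R; x \<in> carrier M\<rbrakk> \<Longrightarrow>
        (a \<oplus>\<^bsub>R\<^esub> b) \<odot>\<^bsub>M\<^esub> x = a \<odot>\<^bsub>M\<^esub> x \<oplus>\<^bsub>M\<^esub> b \<odot>\<^bsub>M\<^esub> x"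
    and smult_r_distr:
      "\<lbrakk>a \<in> carrier R; x \<in> carrier M; y \<in> carrier M\<rbrakk> \<Longrightarrow>
        a \<odot>\<^bsub>M\<^esub> (x \<oplus>\<^bsub>M\<^esub> y) = a \<odot>\<^bsub>M\<^esub> x \<oplus>\<^bsub>M\<^esub> a \<odot>\<^bsub>M\<^esub> y"
    and smult_assoc1:
      "\<lbrakk>a \<in> carrier R; b \<in> carrier R; x \<in> carrier M\<rbrakk> \<Longrightarrow>
        (a \<otimes>\<^bsub>R\<^esub> b) \<odot>\<^bsub>M\<^esub> x = a \<odot>\<^bsub>M\<^esub> (b \<odot>\<^bsub>M\<^esub> x)"
    and smult_one [simp]: "x \<in> carrier M \<Longrightarrow> \<one>\<^bsub>R\<^esub> \<odot>\<^bsub>M\<^esub> x = x"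

definition small_module :: "'r ring \<Rightarrow> ('r, 'u::universe) module \<Rightarrow> bool"
  where "small_module R N \<longleftrightarrow> left_module R N \<and> small (carrier N)"

text \<open>Homomorphisms are extensional, so that equality of morphisms is equality of functions.\<close>

definition module_homs ::
    "'r ring \<Rightarrow> ('r, 'u) module \<Rightarrow> ('r, 'v) module \<Rightarrow> ('u \<Rightarrow> 'v) set"
  where "module_homs R N P =
    {f \<in> carrier N \<rightarrow>\<^sub>E carrier P.
      (\<forall>x\<in>carrier N. \<forall>y\<in>carrier N. f (x \<oplus>\<^bsub>N\<^esub> y) = f x \<oplus>\<^bsub>P\<^esub> f y) \<and>
      (\<forall>a\<in>carrier R. \<forall>x\<in>carrier N. f (a \<odot>\<^bsub>N\<^esub> x) = a \<odot>\<^bsub>P\<^esub> f x)}"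

text \<open>Abelian groups are \<open>comm_group\<close>s, hence written multiplicatively.\<close>

definition Hom_group ::
    "'r ring \<Rightarrow> ('r, 'u) module \<Rightarrow> ('r, 'v) module \<Rightarrow> ('u \<Rightarrow> 'v) monoid"
  where "Hom_group R N P =
    \<lparr>carrier = module_homs R N P,
     mult = (\<lambda>f g. \<lambda>x\<in>carrier N. f x \<oplus>\<^bsub>P\<^esub> g x),
     one = (\<lambda>x\<in>carrier N. \<zero>\<^bsub>P\<^esub>)\<rparr>"


section \<open>Functors from modules to abelian groups\<close>

text \<open>
  \<open>farr F N P f\<close> is the value of \<open>F\<close> at the morphism \<open>f\<close> from \<open>N\<close> to \<open>P\<close>. Only values at small
  modules matter, and functions between groups only matter on the carriers. The groups
  \<open>fobj F N\<close> may live on any type; no smallness is imposed on them.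
\<close>

record ('r, 'u, 'm) rfun =
  fobj :: "('r, 'u) module \<Rightarrow> 'm monoid"
  farr :: "('r, 'u) module \<Rightarrow> ('r, 'u) module \<Rightarrow> ('u \<Rightarrow> 'u) \<Rightarrow> 'm \<Rightarrow> 'm"

definition R_functor :: "'r ring \<Rightarrow> ('r, 'u::universe, 'm) rfun \<Rightarrow> bool"
  where "R_functor R F \<longleftrightarrow>
    (\<forall>N. small_module R N \<longrightarrow> comm_group (fobj F N)) \<and>
    (\<forall>N P. small_module R N \<longrightarrow> small_module R P \<longrightarrow>
      (\<forall>f\<in>module_homs R N P. farr F N P f \<in> hom (fobj F N) (fobj F P))) \<and>
    (\<forall>N. small_module R N \<longrightarrow>
      (\<forall>m\<in>carrier (fobj F N). farr F N N (\<lambda>x\<in>carrier N. x) m = m)) \<and>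
    (\<forall>N P Q. small_module R N \<longrightarrow> small_module R P \<longrightarrow> small_module R Q \<longrightarrow>
      (\<forall>f\<in>module_homs R N P. \<forall>g\<in>module_homs R P Q. \<forall>m\<in>carrier (fobj F N).
        farr F N Q (compose (carrier N) g f) m = farr F P Q g (farr F N P f m))) \<and>
    (\<forall>N P. small_module R N \<longrightarrow> small_module R P \<longrightarrow>
      (\<forall>f\<in>module_homs R N P. \<forall>g\<in>module_homs R N P. \<forall>m\<in>carrier (fobj F N).
        farr F N P (f \<otimes>\<^bsub>Hom_group R N P\<^esub> g) m = farr F N P f m \<otimes>\<^bsub>fobj F P\<^esub> farr F N P g m))"

definition R_morphism ::
    "'r ring \<Rightarrow> ('r, 'u::universe, 'a) rfun \<Rightarrow> ('r, 'u, 'b) rfun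
      \<Rightarrow> (('r, 'u) module \<Rightarrow> 'a \<Rightarrow> 'b) \<Rightarrow> bool"
  where "R_morphism R F G \<eta> \<longleftrightarrow>
    (\<forall>N. small_module R N \<longrightarrow> \<eta> N \<in> hom (fobj F N) (fobj G N)) \<and>
    (\<forall>N P. small_module R N \<longrightarrow> small_module R P \<longrightarrow>
      (\<forall>f\<in>module_homs R N P. \<forall>m\<in>carrier (fobj F N).
        \<eta> P (farr F N P f m) = farr G N P f (\<eta> N m)))"

definition R_epimorphism ::
    "'r ring \<Rightarrow> ('r, 'u::universe, 'a) rfun \<Rightarrow> ('r, 'u, 'b) rfun
      \<Rightarrow> (('r, 'u) module \<Rightarrow> 'a \<Rightarrow> 'b) \<Rightarrow> bool"
  where "R_epimorphism R F G \<eta> \<longleftrightarrow> R_morphism R F G \<eta> \<and>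
    (\<forall>N. small_module R N \<longrightarrow> \<eta> N ` carrier (fobj F N) = carrier (fobj G N))"

definition R_isomorphic ::
    "'r ring \<Rightarrow> ('r, 'u::universe, 'a) rfun \<Rightarrow> ('r, 'u, 'b) rfun \<Rightarrow> bool"
  where "R_isomorphic R F G \<longleftrightarrow> (\<exists>\<eta>. R_morphism R F G \<eta> \<and>
    (\<forall>N. small_module R N \<longrightarrow> \<eta> N \<in> iso (fobj F N) (fobj G N)))"

definition module_scheme ::
    "'r ring \<Rightarrow> ('r, 'u) module \<Rightarrow> ('r, 'u, 'u \<Rightarrow> 'u) rfun"
  where "module_scheme R N =
    \<lparr>fobj = Hom_group R N, farr = (\<lambda>P Q f h. compose (carrier N) f h)\<rparr>"

definition direct_sum :: "'l set \<Rightarrow> ('l \<Rightarrow> ('r, 'u, 'm) rfun) \<Rightarrow> ('r, 'u, 'l \<Rightarrow> 'm) rfun"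
  where "direct_sum L F =
    \<lparr>fobj = (\<lambda>N. sum_group L (\<lambda>l. fobj (F l) N)),
     farr = (\<lambda>N P f m. \<lambda>l\<in>L. farr (F l) N P f (m l))\<rparr>"


section \<open>Submodules and submodule schemes\<close>

text \<open>A submodule is given by its underlying subsets; \<open>restrict_functor\<close> makes it a functor.\<close>

definition R_submodule ::
    "'r ring \<Rightarrow> ('r, 'u::universe, 'm) rfun \<Rightarrow> (('r, 'u) module \<Rightarrow> 'm set) \<Rightarrow> bool"
  where "R_submodule R M S \<longleftrightarrow>
    (\<forall>N. small_module R N \<longrightarrow> subgroup (S N) (fobj M N)) \<and>
    (\<forall>N P. small_module R N \<longrightarrow> small_module R P \<longrightarrow>
      (\<forall>f\<in>module_homs R N P. farr M N P f ` S N \<subseteq> S P))"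

definition restrict_functor ::
    "('r, 'u, 'm) rfun \<Rightarrow> (('r, 'u) module \<Rightarrow> 'm set) \<Rightarrow> ('r, 'u, 'm) rfun"
  where "restrict_functor M S = M\<lparr>fobj := (\<lambda>N. (fobj M N)\<lparr>carrier := S N\<rparr>)\<rparr>"

definition submodule_scheme ::
    "'r ring \<Rightarrow> ('r, 'u::universe, 'm) rfun \<Rightarrow> (('r, 'u) module \<Rightarrow> 'm set) \<Rightarrow> bool"
  where "submodule_scheme R M S \<longleftrightarrow> R_submodule R M S \<and>
    (\<exists>N. small_module R N \<and> R_isomorphic R (restrict_functor M S) (module_scheme R N))"

text \<open>The inclusion of the submodule \<open>S\<close> into \<open>M\<close> is the identity on elements.\<close>

definition factors_through ::
    "'r ring \<Rightarrow> ('r, 'u::universe, 'a) rfun \<Rightarrow> ('r, 'u, 'm) rfun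
      \<Rightarrow> (('r, 'u) module \<Rightarrow> 'a \<Rightarrow> 'm) \<Rightarrow> (('r, 'u) module \<Rightarrow> 'm set) \<Rightarrow> bool"
  where "factors_through R F M \<eta> S \<longleftrightarrow>
    (\<exists>\<theta>. R_morphism R F (restrict_functor M S) \<theta> \<and>
      (\<forall>P. small_module R P \<longrightarrow> (\<forall>m\<in>carrier (fobj F P). \<eta> P m = \<theta> P m)))"

definition direct_limit_of_submodule_schemes ::
    "'r ring \<Rightarrow> ('r, 'u::universe, 'm) rfun \<Rightarrow> bool"
  where "direct_limit_of_submodule_schemes R M \<longleftrightarrow>
    (\<exists>(I :: 'u set) S. small I \<and> I \<noteq> {} \<and>
      (\<forall>i\<in>I. submodule_scheme R M (S i)) \<and>
      (\<forall>i\<in>I. \<forall>j\<in>I. \<exists>k\<in>I. \<forall>N. small_module R N \<longrightarrow> S i N \<subseteq> S k N \<and> S j N \<subseteq> S k N) \<and>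
      (\<forall>N. small_module R N \<longrightarrow> carrier (fobj M N) = (\<Union>i\<in>I. S i N)))"


section \<open>Left exactness and the Mittag-Leffler condition\<close>

definition left_exact :: "'r ring \<Rightarrow> ('r, 'u::universe, 'm) rfun \<Rightarrow> bool"
  where "left_exact R M \<longleftrightarrow>
    (\<forall>A B C. small_module R A \<longrightarrow> small_module R B \<longrightarrow> small_module R C \<longrightarrow>
      (\<forall>f\<in>module_homs R A B. \<forall>g\<in>module_homs R B C.
        inj_on f (carrier A) \<longrightarrow> f ` carrier A = {x \<in> carrier B. g x = \<zero>\<^bsub>C\<^esub>} \<longrightarrow>
        inj_on (farr M A B f) (carrier (fobj M A)) \<and>
        farr M A B f ` carrier (fobj M A) = kernel (fobj M B) (fobj M C) (farr M B C g)))"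

text \<open>
  The set of families \<open>\<Pi>\<^sub>E i\<in>I. carrier (N i)\<close> has elements of type \<open>'u \<Rightarrow> 'u\<close>, so the product
  is any module on the type \<open>'u\<close> that is identified with this set by projections \<open>p i\<close> which are
  homomorphisms. That such a module exists for every small family is \<open>product_cone_exists\<close> below,
  and a functor does not distinguish between two of them. Index sets are subsets of \<open>'u\<close>, which
  is no restriction on small sets.
\<close>

definition product_cone ::
    "'r ring \<Rightarrow> 'u set \<Rightarrow> ('u \<Rightarrow> ('r, 'u::universe) module) \<Rightarrow> ('r, 'u) module
      \<Rightarrow> ('u \<Rightarrow> 'u \<Rightarrow> 'u) \<Rightarrow> bool"
  where "product_cone R I N P p \<longleftrightarrow> small_module R P \<and>
    (\<forall>i\<in>I. p i \<in> module_homs R P (N i)) \<and>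
    bij_betw (\<lambda>x. \<lambda>i\<in>I. p i x) (carrier P) (\<Pi>\<^sub>E i\<in>I. carrier (N i))"

lemma finite_card_of_less_iff:
  assumes "finite A" "finite B"
  shows "|A| <o |B| \<longleftrightarrow> card A < card B"
proof -
  have "|A| <o |B| \<longleftrightarrow> \<not> card B \<le> card A"
    using assms by (simp only: card_of_ordLess[symmetric] inj_on_iff_card_le)
  then show ?thesis by auto
qed

lemma infinite_universe: "infinite (UNIV :: 'u::universe set)"
proof
  assume fin: "finite (UNIV :: 'u set)"
  obtain a :: 'u where True by blast
  have fin': "finite (UNIV - {a})" "finite (Pow (UNIV - {a}))"
    using fin by (auto intro: finite_subset[OF subset_UNIV])
  have "card (UNIV - {a}) < card (UNIV :: 'u set)"
    using fin by (intro psubset_card_mono) auto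
  then have "|UNIV - {a}| <o |UNIV :: 'u set|"
    using fin fin' by (simp add: finite_card_of_less_iff)
  then have "|Pow (UNIV - {a})| <o |UNIV :: 'u set|"
    by (rule small_Pow)
  then have "card (Pow (UNIV - {a})) < card (UNIV :: 'u set)"
    using fin fin' by (simp add: finite_card_of_less_iff)
  then have "2 ^ (card (UNIV :: 'u set) - 1) < card (UNIV :: 'u set)"
    using fin fin' by (simp add: card_Pow)
  moreover have "card (UNIV :: 'u set) - 1 < 2 ^ (card (UNIV :: 'u set) - 1)"
    by (rule less_exp)
  ultimately show False
    by linarith
qed

lemma card_Times_universe:
  assumes "|A| <o |UNIV :: 'u::universe set|" "|B| <o |UNIV :: 'u set|"
  shows "|A \<times> B| <o |UNIV :: 'u set|"
proof -
  consider "finite (A \<times> B)" | "infinite A" "B \<noteq> {}" "|B| \<le>o |A|"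
    | "infinite B" "A \<noteq> {}" "|A| \<le>o |B|"
  proof (cases "|A| \<le>o |B|")
    case True
    then show ?thesis
      using that card_of_ordLeq_finite[of A B] by (cases "A = {}") auto
  next
    case False
    then have "|B| \<le>o |A|"
      using ordLeq_total[OF card_of_Well_order card_of_Well_order] by blast
    then show ?thesis
      using that card_of_ordLeq_finite[of B A] by (cases "B = {}") auto
  qed
  then show ?thesis
  proof cases
    case 1
    then show ?thesis
      using infinite_universe
      by (intro finite_ordLess_infinite card_of_Well_order) (simp_all add: Field_card_of)
  next
    case 2
    then show ?thesis
      using ordIso_ordLess_trans[OF _ assms(1)] card_of_Times_infinite[of A B] by blast
  next
    case 3
    then show ?thesis
      using ordIso_ordLess_trans[OF _ assms(2)] card_of_Times_infinite[of B A] by blast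
  qed
qed

lemma card_Pow_universe:
  assumes "|A| <o |UNIV :: 'u::universe set|"
  shows "|Pow A| <o |UNIV :: 'u set|"
proof -
  obtain f where f: "inj_on f A" "f ` A \<subseteq> (UNIV :: 'u set)"
    using ordLess_imp_ordLeq[OF assms] by (auto simp: card_of_ordLeq[symmetric])
  have eq: "|A| =o |f ` A|"
    using f(1) by (auto intro!: card_of_ordIsoI simp: bij_betw_def)
  then have "|f ` A| <o |UNIV :: 'u set|"
    using assms ordIso_symmetric ordIso_ordLess_trans by blast
  then have "|Pow (f ` A)| <o |UNIV :: 'u set|"
    by (rule small_Pow)
  moreover have "|Pow A| =o |Pow (f ` A)|"
    using f(1) by (auto intro!: card_of_ordIsoI bij_betw_Pow simp: bij_betw_def)
  ultimately show ?thesis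
    by (rule ordIso_ordLess_trans[rotated])
qed

lemma card_PiE_universe:
  fixes N :: "'u::universe \<Rightarrow> 'u set"
  assumes "small I" "\<And>i. i \<in> I \<Longrightarrow> small (N i)"
  shows "|\<Pi>\<^sub>E i\<in>I. N i| <o |UNIV :: 'u set|"
proof -
  let ?U = "\<Union>i\<in>I. N i"
  have "|?U| <o |UNIV :: 'u set|"
    using assms unfolding small_def by (rule small_UN)
  then have "|I \<times> ?U| <o |UNIV :: 'u set|"
    using assms(1) unfolding small_def by (rule card_Times_universe[rotated])
  then have "|Pow (I \<times> ?U)| <o |UNIV :: 'u set|"
    by (rule card_Pow_universe)
  moreover have "|\<Pi>\<^sub>E i\<in>I. N i| \<le>o |Pow (I \<times> ?U)|"
  proof (rule card_of_ordLeqI)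
    let ?g = "\<lambda>f. (\<lambda>i. (i, f i)) ` I"
    show "inj_on ?g (\<Pi>\<^sub>E i\<in>I. N i)"
    proof (rule inj_onI)
      fix f g assume fg: "f \<in> (\<Pi>\<^sub>E i\<in>I. N i)" "g \<in> (\<Pi>\<^sub>E i\<in>I. N i)" "?g f = ?g g"
      show "f = g"
      proof (rule PiE_ext[OF fg(1,2)])
        fix i assume "i \<in> I"
        then have "(i, f i) \<in> ?g g" using fg(3) by blast
        then show "f i = g i" by auto
      qed
    qed
    show "?g f \<in> Pow (I \<times> ?U)" if "f \<in> (\<Pi>\<^sub>E i\<in>I. N i)" for f
      using that by auto
  qed
  ultimately show ?thesis
    using ordLeq_ordLess_trans by blast
qed

lemma product_cone_exists:
  fixes N :: "'u::universe \<Rightarrow> ('r, 'u) module"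
  assumes "ring R" "small I" "\<And>i. i \<in> I \<Longrightarrow> small_module R (N i)"
  shows "\<exists>P p. product_cone R I N P p"
proof -
  let ?X = "\<Pi>\<^sub>E i\<in>I. carrier (N i)"
  interpret R: ring R by fact
  have N: "left_module R (N i)" if "i \<in> I" for i
    using assms(3)[OF that] by (simp add: small_module_def)
  have ag: "abelian_group (N i)" if "i \<in> I" for i
    using N[OF that] by (simp add: left_module_def)
  have X: "|?X| <o |UNIV :: 'u set|"
    using assms by (intro card_PiE_universe) (auto simp: small_module_def)
  obtain e :: "('u \<Rightarrow> 'u) \<Rightarrow> 'u" where e: "inj_on e ?X"
    using ordLess_imp_ordLeq[OF X] by (auto simp: card_of_ordLeq[symmetric])
  define d where "d = the_inv_into ?X e"
  have de: "d (e x) = x" if "x \<in> ?X" for x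
    using the_inv_into_f_f[OF e that] by (simp add: d_def)
  define P :: "('r, 'u) module" where "P =
    \<lparr>carrier = e ` ?X, mult = (\<lambda>x y. x), one = undefined,
     zero = e (\<lambda>i\<in>I. \<zero>\<^bsub>N i\<^esub>), add = (\<lambda>x y. e (\<lambda>i\<in>I. d x i \<oplus>\<^bsub>N i\<^esub> d y i)),
     smult = (\<lambda>a x. e (\<lambda>i\<in>I. a \<odot>\<^bsub>N i\<^esub> d x i))\<rparr>"
  define p where "p = (\<lambda>i. \<lambda>x\<in>carrier P. d x i)"
  have zX: "(\<lambda>i\<in>I. \<zero>\<^bsub>N i\<^esub>) \<in> ?X"
    using ag by (auto simp: abelian_group_def abelian_monoid.zero_closed)
  have aX: "(\<lambda>i\<in>I. x i \<oplus>\<^bsub>N i\<^esub> y i) \<in> ?X" if "x \<in> ?X" "y \<in> ?X" for x y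
    using that ag by (auto simp: abelian_group_def PiE_iff intro!: abelian_monoid.a_closed)
  have sX: "(\<lambda>i\<in>I. a \<odot>\<^bsub>N i\<^esub> x i) \<in> ?X" if "a \<in> carrier R" "x \<in> ?X" for a x
    using that N by (auto simp: PiE_iff intro!: left_module.smult_closed)
  have [simp]: "carrier P = e ` ?X" "\<zero>\<^bsub>P\<^esub> = e (\<lambda>i\<in>I. \<zero>\<^bsub>N i\<^esub>)"
    "x \<oplus>\<^bsub>P\<^esub> y = e (\<lambda>i\<in>I. d x i \<oplus>\<^bsub>N i\<^esub> d y i)"
    "a \<odot>\<^bsub>P\<^esub> x = e (\<lambda>i\<in>I. a \<odot>\<^bsub>N i\<^esub> d x i)" for x y a
    by (simp_all add: P_def)
  have eqI: "e (restrict f I) = e (restrict g I)" if "\<And>i. i \<in> I \<Longrightarrow> f i = g i" for f g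
    using that by (metis (mono_tags, lifting) restrict_ext)
  have memX: "x i \<in> carrier (N i)" if "x \<in> ?X" "i \<in> I" for x i
    using that by auto
  have eqX: "e (restrict f I) = e x" if "x \<in> ?X" "\<And>i. i \<in> I \<Longrightarrow> f i = x i" for f x
  proof -
    have "restrict f I = x" using that by (auto simp: PiE_iff extensional_def fun_eq_iff)
    then show ?thesis by simp
  qed
  have "abelian_group P"
  proof (rule abelian_groupI)
    fix x y assume "x \<in> carrier P" "y \<in> carrier P"
    then show "x \<oplus>\<^bsub>P\<^esub> y \<in> carrier P" "x \<oplus>\<^bsub>P\<^esub> y = y \<oplus>\<^bsub>P\<^esub> x"
      using aX ag
      by (auto simp: de abelian_group_def intro!: eqI abelian_monoid.a_comm dest: memX)
  next
    fix x y z assume "x \<in> carrier P" "y \<in> carrier P" "z \<in> carrier P"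
    then show "x \<oplus>\<^bsub>P\<^esub> y \<oplus>\<^bsub>P\<^esub> z = x \<oplus>\<^bsub>P\<^esub> (y \<oplus>\<^bsub>P\<^esub> z)"
      using ag
      by (auto simp: de[OF aX] de abelian_group_def intro!: eqI abelian_monoid.a_assoc
          dest: memX)
  next
    show "\<zero>\<^bsub>P\<^esub> \<in> carrier P" using zX by simp
  next
    fix x assume "x \<in> carrier P"
    then obtain x' where x': "x' \<in> ?X" "x = e x'" by auto
    show "\<zero>\<^bsub>P\<^esub> \<oplus>\<^bsub>P\<^esub> x = x"
      using x' ag memX[OF x'(1)]
      by (auto simp: de de[OF zX] abelian_group_def intro!: eqX abelian_monoid.l_zero)
    let ?y = "\<lambda>i\<in>I. \<ominus>\<^bsub>N i\<^esub> x' i"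
    have y: "?y \<in> ?X"
      using x' ag memX[OF x'(1)] by (auto intro!: abelian_group.a_inv_closed)
    have "e ?y \<oplus>\<^bsub>P\<^esub> x = \<zero>\<^bsub>P\<^esub>"
      using x' ag memX[OF x'(1)] by (auto simp: de de[OF y] intro!: eqI abelian_group.l_neg)
    moreover have "e ?y \<in> carrier P"
      using y by simp
    ultimately show "\<exists>y\<in>carrier P. y \<oplus>\<^bsub>P\<^esub> x = \<zero>\<^bsub>P\<^esub>"
      by (rule bexI)
  qed
  then have "left_module R P"
  proof (intro left_module.intro left_module_axioms.intro \<open>ring R\<close>)
    fix a x assume "a \<in> carrier R" "x \<in> carrier P"
    then show "a \<odot>\<^bsub>P\<^esub> x \<in> carrier P" using sX by (auto simp: de)
  next
    fix a b x assume "a \<in> carrier R" "b \<in> carrier R" "x \<in> carrier P"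
    then show "(a \<oplus>\<^bsub>R\<^esub> b) \<odot>\<^bsub>P\<^esub> x = a \<odot>\<^bsub>P\<^esub> x \<oplus>\<^bsub>P\<^esub> b \<odot>\<^bsub>P\<^esub> x"
      and "(a \<otimes>\<^bsub>R\<^esub> b) \<odot>\<^bsub>P\<^esub> x = a \<odot>\<^bsub>P\<^esub> (b \<odot>\<^bsub>P\<^esub> x)"
      using N by (auto simp: de de[OF sX] intro!: eqI left_module.smult_l_distr
          left_module.smult_assoc1 dest: memX)
  next
    fix a x y assume a: "a \<in> carrier R" and "x \<in> carrier P" "y \<in> carrier P"
    then obtain x' y' where x': "x' \<in> ?X" "x = e x'" and y': "y' \<in> ?X" "y = e y'" by auto
    have "a \<odot>\<^bsub>N i\<^esub> (x' i \<oplus>\<^bsub>N i\<^esub> y' i) = a \<odot>\<^bsub>N i\<^esub> x' i \<oplus>\<^bsub>N i\<^esub> a \<odot>\<^bsub>N i\<^esub> y' i"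
      if "i \<in> I" for i
      using left_module.smult_r_distr[OF N a] that memX x' y' by blast
    then show "a \<odot>\<^bsub>P\<^esub> (x \<oplus>\<^bsub>P\<^esub> y) = a \<odot>\<^bsub>P\<^esub> x \<oplus>\<^bsub>P\<^esub> a \<odot>\<^bsub>P\<^esub> y"
      using a x' y' by (auto simp: de de[OF sX] de[OF aX] intro!: eqI)
  next
    fix x assume "x \<in> carrier P"
    then obtain x' where x': "x' \<in> ?X" "x = e x'" by auto
    then show "\<one>\<^bsub>R\<^esub> \<odot>\<^bsub>P\<^esub> x = x"
      using left_module.smult_one[OF N] memX[OF x'(1)] by (auto simp: de intro!: eqX)
  qed
  moreover have "small (carrier P)"
  proof -
    have "|e ` ?X| \<le>o |?X|" by (rule card_of_image)
    then show ?thesis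
      using ordLeq_ordLess_trans[OF _ X] by (simp add: small_def)
  qed
  moreover have "p i \<in> module_homs R P (N i)" if "i \<in> I" for i
    using that by (auto simp: module_homs_def p_def de de[OF aX] de[OF sX] imageI[OF aX] imageI[OF sX])
  moreover have "bij_betw (\<lambda>x. \<lambda>i\<in>I. p i x) (carrier P) ?X"
  proof (rule bij_betw_byWitness[where f' = e])
    have *: "(\<lambda>i\<in>I. p i (e x)) = x" if "x \<in> ?X" for x
    proof -
      have "(\<lambda>i\<in>I. p i (e x)) = restrict x I"
        using that by (intro restrict_ext) (simp add: p_def de)
      then show ?thesis using PiE_restrict[OF that] by simp
    qed
    show "\<forall>a\<in>carrier P. e (\<lambda>i\<in>I. p i a) = a"
      using * by auto
    show "\<forall>a'\<in>?X. (\<lambda>i\<in>I. p i (e a')) = a'"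
      using * by blast
    show "(\<lambda>x. \<lambda>i\<in>I. p i x) ` carrier P \<subseteq> ?X"
    proof (rule image_subsetI)
      fix x assume "x \<in> carrier P"
      then obtain x' where x': "x' \<in> ?X" "x = e x'" by auto
      then show "(\<lambda>i\<in>I. p i x) \<in> ?X" using *[OF x'(1)] by simp
    qed
    show "e ` ?X \<subseteq> carrier P"
      by simp
  qed
  ultimately have "product_cone R I N P p"
    unfolding product_cone_def small_module_def by blast
  then show ?thesis
    by blast
qed

definition Mittag_Leffler :: "'r ring \<Rightarrow> ('r, 'u::universe, 'm) rfun \<Rightarrow> bool"
  where "Mittag_Leffler R M \<longleftrightarrow>
    (\<forall>(I :: 'u set) N P p. small I \<longrightarrow> (\<forall>i\<in>I. small_module R (N i)) \<longrightarrow>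
      product_cone R I N P p \<longrightarrow>
      inj_on (\<lambda>m. \<lambda>i\<in>I. farr M P (N i) (p i) m) (carrier (fobj M P)))"

end

theory Submission
  imports Defs
begin

text \<open>
  By the Yoneda lemma a morphism from the module scheme of \<open>N\<close> to \<open>M\<close> is an element of \<open>M(N)\<close>: the
  element \<open>m\<close> sends \<open>f : N \<rightarrow> P\<close> to \<open>M(f)(m)\<close>. Under this dictionary a submodule scheme is given
  by a module \<open>N\<close> and an element \<open>s \<in> M(N)\<close> for which \<open>f \<mapsto> M(f)(s)\<close> is injective
  (\<open>mono_element\<close>, \<open>mono_element_submodule_scheme\<close>, \<open>submodule_scheme_generator\<close>), and the second
  statement of the theorem says that each element of \<open>M\<close> lies in some submodule scheme
  (\<open>factorization_iff_covered\<close>). It is this covering property that is compared with the other two.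

  Let \<open>M\<close> be left exact and Mittag-Leffler, and let \<open>m \<in> M(N)\<close>. A submodule \<open>K\<close> of \<open>N\<close> supports \<open>m\<close>
  if \<open>m\<close> comes from \<open>M(K)\<close>, and then \<open>m\<close> vanishes in \<open>M(N/K)\<close>. Hence \<open>m\<close> vanishes in the value at
  the product of all these quotients, by the Mittag-Leffler condition, and left exactness moves \<open>m\<close> into
  the value at the kernel of \<open>N \<rightarrow> \<Prod> N/K\<close>, which is the intersection \<open>N\<^sub>0\<close> of all supporting
  submodules. So \<open>N\<^sub>0\<close> is the least support of \<open>m\<close>. If \<open>s \<in> M(N\<^sub>0)\<close> is the preimage of \<open>m\<close> and
  \<open>M(f)(s) = 0\<close>, then left exactness makes the kernel of \<open>f\<close> a support of \<open>m\<close>, so that \<open>f = 0\<close> by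
  minimality. Thus \<open>s\<close> generates a submodule scheme, and this scheme contains \<open>m\<close>
  (\<open>left_exact_Mittag_Leffler_imp_covered\<close>).

  If the submodule schemes cover \<open>M\<close>, then any two of them lie in a third: a scheme that contains
  the sum of the two generators in \<open>M(N\<^sub>1 \<times> N\<^sub>2)\<close> contains both generators, which are its
  projections (\<open>upper_bound_scheme\<close>). So the class of all submodule schemes is directed with union
  \<open>M\<close>, and the epimorphism serves to extract a small cofinal subfamily. For each finite
  \<open>F \<subseteq> L\<close> some scheme contains the image of the sum of the \<open>W\<^sub>l\<^sup>*\<close> with \<open>l \<in> F\<close>
  (\<open>value_at_sum_in_scheme\<close>), and one such scheme for each \<open>F\<close> suffices, because the generator of an
  arbitrary scheme is the image of an element of finite support (\<open>covered_imp_direct_limit\<close>).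

  Finally, module schemes are left exact and commute with products. As any two elements of a directed
  union of submodule schemes lie in one of them, both properties pass to the union
  (\<open>direct_limit_imp_left_exact\<close>, \<open>direct_limit_imp_Mittag_Leffler\<close>).
\<close>

section \<open>Small sets and homomorphisms of modules\<close>

lemma small_subset: "small B \<Longrightarrow> A \<subseteq> B \<Longrightarrow> small A"
  unfolding small_def using card_of_mono1 ordLeq_ordLess_trans by blast

lemma small_image: "small A \<Longrightarrow> small (f ` A)"
  for A :: "'u::universe set" and f :: "'u \<Rightarrow> 'u"
  unfolding small_def by (rule ordLeq_ordLess_trans[OF card_of_image])

lemma finite_imp_small: "finite A \<Longrightarrow> small (A :: 'u::universe set)"
  unfolding small_def using infinite_universe
  by (intro finite_ordLess_infinite card_of_Well_order) (simp_all add: Field_card_of)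

lemma small_module_imp_left_module: "small_module R N \<Longrightarrow> left_module R N"
  by (simp add: small_module_def)

lemma (in left_module) smult_zero [simp]:
  assumes "a \<in> carrier R" shows "a \<odot>\<^bsub>M\<^esub> \<zero>\<^bsub>M\<^esub> = \<zero>\<^bsub>M\<^esub>"
proof -
  have "a \<odot>\<^bsub>M\<^esub> \<zero>\<^bsub>M\<^esub> \<oplus>\<^bsub>M\<^esub> a \<odot>\<^bsub>M\<^esub> \<zero>\<^bsub>M\<^esub> = a \<odot>\<^bsub>M\<^esub> \<zero>\<^bsub>M\<^esub>"
    using assms smult_r_distr[of a "\<zero>\<^bsub>M\<^esub>" "\<zero>\<^bsub>M\<^esub>"] by simp
  then show ?thesis
    using assms by (simp only: M.add.l_cancel_one smult_closed M.zero_closed)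
qed

lemma (in left_module) smult_uminus:
  assumes "a \<in> carrier R" "x \<in> carrier M"
  shows "a \<odot>\<^bsub>M\<^esub> (\<ominus>\<^bsub>M\<^esub> x) = \<ominus>\<^bsub>M\<^esub> (a \<odot>\<^bsub>M\<^esub> x)"
proof -
  have "a \<odot>\<^bsub>M\<^esub> (\<ominus>\<^bsub>M\<^esub> x) \<oplus>\<^bsub>M\<^esub> a \<odot>\<^bsub>M\<^esub> x = \<zero>\<^bsub>M\<^esub>"
    using assms smult_r_distr[of a "\<ominus>\<^bsub>M\<^esub> x" x] by (simp add: M.l_neg)
  then show ?thesis
    using assms by (metis M.minus_equality M.a_inv_closed smult_closed)
qed

lemma module_homsD:
  assumes "f \<in> module_homs R N P"
  shows "f \<in> extensional (carrier N)"
    and "x \<in> carrier N \<Longrightarrow> f x \<in> carrier P"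
    and "x \<in> carrier N \<Longrightarrow> y \<in> carrier N \<Longrightarrow> f (x \<oplus>\<^bsub>N\<^esub> y) = f x \<oplus>\<^bsub>P\<^esub> f y"
    and "a \<in> carrier R \<Longrightarrow> x \<in> carrier N \<Longrightarrow> f (a \<odot>\<^bsub>N\<^esub> x) = a \<odot>\<^bsub>P\<^esub> f x"
  using assms by (auto simp: module_homs_def PiE_iff)

lemma module_homsI:
  assumes "f \<in> extensional (carrier N)"
    and "\<And>x. x \<in> carrier N \<Longrightarrow> f x \<in> carrier P"
    and "\<And>x y. x \<in> carrier N \<Longrightarrow> y \<in> carrier N \<Longrightarrow> f (x \<oplus>\<^bsub>N\<^esub> y) = f x \<oplus>\<^bsub>P\<^esub> f y"
    and "\<And>a x. a \<in> carrier R \<Longrightarrow> x \<in> carrier N \<Longrightarrow> f (a \<odot>\<^bsub>N\<^esub> x) = a \<odot>\<^bsub>P\<^esub> f x"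
  shows "f \<in> module_homs R N P"
  using assms by (auto simp: module_homs_def PiE_iff)

lemma module_hom_ext:
  assumes "f \<in> module_homs R N P" "g \<in> module_homs R N Q"
    and "\<And>x. x \<in> carrier N \<Longrightarrow> f x = g x"
  shows "f = g"
  using assms module_homsD(1) by (metis extensionalityI)

lemma module_hom_zero:
  assumes "left_module R N" "left_module R P" "f \<in> module_homs R N P"
  shows "f \<zero>\<^bsub>N\<^esub> = \<zero>\<^bsub>P\<^esub>"
proof -
  interpret N: left_module R N by fact
  interpret P: left_module R P by fact
  have "f \<zero>\<^bsub>N\<^esub> \<oplus>\<^bsub>P\<^esub> f \<zero>\<^bsub>N\<^esub> = f \<zero>\<^bsub>N\<^esub>"
    using module_homsD(2,3)[OF assms(3), of "\<zero>\<^bsub>N\<^esub>"] by (simp add: N.l_zero)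
  then show ?thesis
    using module_homsD(2)[OF assms(3)] by (simp only: P.add.l_cancel_one P.zero_closed N.zero_closed)
qed

lemma module_hom_uminus:
  assumes "left_module R N" "left_module R P" "f \<in> module_homs R N P" "x \<in> carrier N"
  shows "f (\<ominus>\<^bsub>N\<^esub> x) = \<ominus>\<^bsub>P\<^esub> f x"
proof -
  interpret N: left_module R N by fact
  interpret P: left_module R P by fact
  have "f (\<ominus>\<^bsub>N\<^esub> x) \<oplus>\<^bsub>P\<^esub> f x = \<zero>\<^bsub>P\<^esub>"
    using module_homsD(3)[OF assms(3), of "\<ominus>\<^bsub>N\<^esub> x" x] assms(4) module_hom_zero[OF assms(1-3)]
    by (simp add: N.l_neg)
  then show ?thesis
    using assms(4) module_homsD(2)[OF assms(3)] by (metis P.minus_equality N.a_inv_closed)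
qed

lemma identity_hom: "left_module R N \<Longrightarrow> (\<lambda>x\<in>carrier N. x) \<in> module_homs R N N"
  by (rule module_homsI)
    (auto simp: left_module_def abelian_group_def abelian_monoid.a_closed
      intro: left_module.smult_closed)

lemma compose_hom:
  assumes "left_module R N" "f \<in> module_homs R N P" "g \<in> module_homs R P Q"
  shows "compose (carrier N) g f \<in> module_homs R N Q"
proof -
  interpret N: left_module R N by fact
  show ?thesis
    using module_homsD[OF assms(2)] module_homsD[OF assms(3)]
    by (intro module_homsI) (auto simp: compose_def)
qed

lemma zero_hom:
  assumes "left_module R N" "left_module R P"
  shows "(\<lambda>x\<in>carrier N. \<zero>\<^bsub>P\<^esub>) \<in> module_homs R N P"
proof -
  interpret N: left_module R N by fact
  interpret P: left_module R P by fact
  show ?thesis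
    by (intro module_homsI) auto
qed

lemma add_hom:
  assumes "left_module R N" "left_module R P" "f \<in> module_homs R N P" "g \<in> module_homs R N P"
  shows "(\<lambda>x\<in>carrier N. f x \<oplus>\<^bsub>P\<^esub> g x) \<in> module_homs R N P"
proof -
  interpret N: left_module R N by fact
  interpret P: left_module R P by fact
  note f = module_homsD[OF assms(3)] and g = module_homsD[OF assms(4)]
  show ?thesis
    using f g by (intro module_homsI) (auto simp: P.a_ac P.smult_r_distr)
qed

lemma uminus_hom:
  assumes "left_module R N" "left_module R P" "f \<in> module_homs R N P"
  shows "(\<lambda>x\<in>carrier N. \<ominus>\<^bsub>P\<^esub> f x) \<in> module_homs R N P"
proof -
  interpret N: left_module R N by fact
  interpret P: left_module R P by fact
  note f = module_homsD[OF assms(3)]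
  show ?thesis
    using f by (intro module_homsI) (auto simp: P.minus_add P.smult_uminus)
qed

lemma Hom_group_group:
  assumes "left_module R N" "left_module R P"
  shows "group (Hom_group R N P)"
proof -
  interpret N: left_module R N by fact
  interpret P: left_module R P by fact
  show ?thesis
  proof (rule groupI)
    fix f assume "f \<in> carrier (Hom_group R N P)"
    then have f: "f \<in> module_homs R N P" by (simp add: Hom_group_def)
    show "\<one>\<^bsub>Hom_group R N P\<^esub> \<otimes>\<^bsub>Hom_group R N P\<^esub> f = f"
      using module_homsD(1,2)[OF f] by (auto simp: Hom_group_def extensional_def fun_eq_iff)
    have "(\<lambda>x\<in>carrier N. \<ominus>\<^bsub>P\<^esub> f x) \<otimes>\<^bsub>Hom_group R N P\<^esub> f = \<one>\<^bsub>Hom_group R N P\<^esub>"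
      using module_homsD(2)[OF f] by (auto simp: Hom_group_def P.l_neg intro!: restrict_ext)
    then show "\<exists>g\<in>carrier (Hom_group R N P). g \<otimes>\<^bsub>Hom_group R N P\<^esub> f = \<one>\<^bsub>Hom_group R N P\<^esub>"
      using uminus_hom[OF assms f] by (intro bexI) (simp_all add: Hom_group_def)
  next
    fix f g h
    assume "f \<in> carrier (Hom_group R N P)" "g \<in> carrier (Hom_group R N P)"
      "h \<in> carrier (Hom_group R N P)"
    then show "f \<otimes>\<^bsub>Hom_group R N P\<^esub> g \<otimes>\<^bsub>Hom_group R N P\<^esub> h
        = f \<otimes>\<^bsub>Hom_group R N P\<^esub> (g \<otimes>\<^bsub>Hom_group R N P\<^esub> h)"
      using module_homsD(2)[of f R N P] module_homsD(2)[of g R N P] module_homsD(2)[of h R N P]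
      by (auto simp: Hom_group_def P.a_assoc intro!: restrict_ext)
  qed (use assms in \<open>auto simp: Hom_group_def intro: add_hom zero_hom\<close>)
qed

section \<open>Submodules, quotients and products\<close>

lemma kernel_submodule:
  assumes "left_module R N" "left_module R P" "f \<in> module_homs R N P"
  shows "submodule {x \<in> carrier N. f x = \<zero>\<^bsub>P\<^esub>} R N"
proof -
  interpret N: left_module R N by fact
  interpret P: left_module R P by fact
  note f = module_homsD[OF assms(3)]
  show ?thesis
    using f module_hom_zero[OF assms] module_hom_uminus[OF assms]
    by (intro submodule.intro N.add.subgroupI submodule_axioms.intro)
      (auto simp flip: a_inv_def)
qed

lemma submodule_small_module:
  assumes "small_module R N" "submodule K R N"
  shows "small_module R (N\<lparr>carrier := K\<rparr>)"
proof -
  interpret N: left_module R N using assms(1) by (rule small_module_imp_left_module)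
  interpret K: submodule K R N by fact
  have sub: "x \<in> K \<Longrightarrow> x \<in> carrier N" for x
    using K.subset by auto
  have "abelian_group (N\<lparr>carrier := K\<rparr>)"
  proof (rule abelian_groupI)
    show "\<exists>y\<in>carrier (N\<lparr>carrier := K\<rparr>). y \<oplus>\<^bsub>N\<lparr>carrier := K\<rparr>\<^esub> x = \<zero>\<^bsub>N\<lparr>carrier := K\<rparr>\<^esub>"
      if "x \<in> carrier (N\<lparr>carrier := K\<rparr>)" for x
      using that K.m_inv_closed[of x] sub[of x] N.l_neg[of x]
      by (auto simp flip: a_inv_def)
    show "x \<oplus>\<^bsub>N\<lparr>carrier := K\<rparr>\<^esub> y \<oplus>\<^bsub>N\<lparr>carrier := K\<rparr>\<^esub> z
        = x \<oplus>\<^bsub>N\<lparr>carrier := K\<rparr>\<^esub> (y \<oplus>\<^bsub>N\<lparr>carrier := K\<rparr>\<^esub> z)"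
      if "x \<in> carrier (N\<lparr>carrier := K\<rparr>)" "y \<in> carrier (N\<lparr>carrier := K\<rparr>)"
        "z \<in> carrier (N\<lparr>carrier := K\<rparr>)" for x y z
      using that sub by (simp add: N.a_assoc)
    show "x \<oplus>\<^bsub>N\<lparr>carrier := K\<rparr>\<^esub> y = y \<oplus>\<^bsub>N\<lparr>carrier := K\<rparr>\<^esub> x"
      if "x \<in> carrier (N\<lparr>carrier := K\<rparr>)" "y \<in> carrier (N\<lparr>carrier := K\<rparr>)" for x y
      using that sub by (simp add: N.a_comm)
  qed (use sub K.m_closed K.one_closed in simp_all)
  then have "left_module R (N\<lparr>carrier := K\<rparr>)"
    by (intro left_module.intro left_module_axioms.intro)
      (use sub K.smult_closed in \<open>auto simp: N.smult_l_distr N.smult_r_distr N.smult_assoc1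
        intro: N.R.ring_axioms\<close>)
  then show ?thesis
    using assms(1) K.subset small_subset[of "carrier N" K] by (auto simp: small_module_def)
qed

lemma inclusion_hom:
  assumes "submodule K R N" "K \<subseteq> K'"
  shows "(\<lambda>x\<in>K. x) \<in> module_homs R (N\<lparr>carrier := K\<rparr>) (N\<lparr>carrier := K'\<rparr>)"
proof -
  interpret K: submodule K R N by fact
  show ?thesis
    using assms(2) K.smult_closed K.m_closed by (intro module_homsI) auto
qed

lemma inclusion_hom_ambient:
  assumes "submodule K R N"
  shows "(\<lambda>x\<in>K. x) \<in> module_homs R (N\<lparr>carrier := K\<rparr>) N"
proof -
  interpret K: submodule K R N by fact
  show ?thesis
    using inclusion_hom[OF assms, of "carrier N"] K.subset by simp
qed

text \<open>
  The inverse in \<open>H\<close> is formed in the additive group of \<open>K\<close>, and has to be identified with the one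
  formed in \<open>N\<close>.
\<close>

lemma submodule_trans:
  assumes "small_module R N" "submodule K R N" "submodule H R (N\<lparr>carrier := K\<rparr>)"
  shows "submodule H R N"
proof -
  interpret N: left_module R N using assms(1) by (rule small_module_imp_left_module)
  interpret A: left_module R "N\<lparr>carrier := K\<rparr>"
    using submodule_small_module[OF assms(1,2)] by (rule small_module_imp_left_module)
  interpret K: submodule K R N by fact
  interpret H: submodule H R "N\<lparr>carrier := K\<rparr>" by fact
  have HK: "x \<in> K" "x \<in> carrier N" if "x \<in> H" for x
    using that H.subset K.subset by auto
  have "\<ominus>\<^bsub>N\<^esub> x \<in> H" if "x \<in> H" for x
  proof -
    have "\<ominus>\<^bsub>N\<lparr>carrier := K\<rparr>\<^esub> x \<in> H"
      using H.m_inv_closed[OF that] by (simp add: a_inv_def)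
    moreover have "\<ominus>\<^bsub>N\<lparr>carrier := K\<rparr>\<^esub> x \<oplus>\<^bsub>N\<^esub> x = \<zero>\<^bsub>N\<^esub>"
      using A.l_neg[of x] HK[OF that] by simp
    ultimately show ?thesis
      using N.minus_equality HK that by metis
  qed
  then show ?thesis
    using HK H.m_closed H.one_closed H.smult_closed
    by (intro submodule.intro subgroup.intro submodule_axioms.intro) (auto simp flip: a_inv_def)
qed

text \<open>
  The quotient must live on the type of \<open>N\<close>, so its elements are representatives of the cosets of
  \<open>K\<close> rather than the cosets: \<open>q\<close> chooses a representative, and every operation of \<open>N\<close> is followed
  by \<open>q\<close>.
\<close>

lemma quotient_exists:
  fixes R :: "'r ring" and N :: "('r, 'u::universe) module"
  assumes "small_module R N" "submodule K R N"
  obtains Q :: "('r, 'u) module" and q where "small_module R Q" "q \<in> module_homs R N Q"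
    and "{x \<in> carrier N. q x = \<zero>\<^bsub>Q\<^esub>} = K"
proof -
  interpret N: left_module R N using assms(1) by (rule small_module_imp_left_module)
  interpret K: submodule K R N by fact
  have Kc: "x \<in> K \<Longrightarrow> x \<in> carrier N" for x
    using K.subset by auto
  have Kneg: "x \<in> K \<Longrightarrow> \<ominus>\<^bsub>N\<^esub> x \<in> K" for x
    using K.m_inv_closed[of x] by (simp add: a_inv_def)
  have minus_zero: "\<ominus>\<^bsub>N\<^esub> \<zero>\<^bsub>N\<^esub> = \<zero>\<^bsub>N\<^esub>"
    by (metis N.minus_equality N.l_zero N.zero_closed)
  define q where "q = (\<lambda>x\<in>carrier N. SOME y. y \<in> carrier N \<and> y \<ominus>\<^bsub>N\<^esub> x \<in> K)"
  have q: "q x \<in> carrier N" "q x \<ominus>\<^bsub>N\<^esub> x \<in> K" if "x \<in> carrier N" for x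
  proof -
    have "x \<in> carrier N \<and> x \<ominus>\<^bsub>N\<^esub> x \<in> K"
      using that K.one_closed by (simp add: N.r_neg a_minus_def)
    from someI[of "\<lambda>y. y \<in> carrier N \<and> y \<ominus>\<^bsub>N\<^esub> x \<in> K", OF this]
    show "q x \<in> carrier N" "q x \<ominus>\<^bsub>N\<^esub> x \<in> K" using that by (auto simp: q_def)
  qed
  have q_eqI: "q x = q y" if "x \<in> carrier N" "y \<in> carrier N" "x \<ominus>\<^bsub>N\<^esub> y \<in> K" for x y
  proof -
    have "z \<ominus>\<^bsub>N\<^esub> x \<in> K \<longleftrightarrow> z \<ominus>\<^bsub>N\<^esub> y \<in> K" if "z \<in> carrier N" for z
    proof -
      have "(z \<ominus>\<^bsub>N\<^esub> x) \<oplus>\<^bsub>N\<^esub> (x \<ominus>\<^bsub>N\<^esub> y) = z \<ominus>\<^bsub>N\<^esub> y"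
        "(z \<ominus>\<^bsub>N\<^esub> y) \<oplus>\<^bsub>N\<^esub> \<ominus>\<^bsub>N\<^esub> (x \<ominus>\<^bsub>N\<^esub> y) = z \<ominus>\<^bsub>N\<^esub> x"
        using that \<open>x \<in> carrier N\<close> \<open>y \<in> carrier N\<close>
        by (simp_all add: a_minus_def N.a_assoc N.minus_add N.r_neg1 N.a_comm[of "\<ominus>\<^bsub>N\<^esub> x"])
      then show ?thesis
        using K.m_closed \<open>x \<ominus>\<^bsub>N\<^esub> y \<in> K\<close> Kneg by (metis monoid.simps(1))
    qed
    then show ?thesis using that(1,2)
      by (auto simp: q_def intro!: arg_cong[of _ _ Eps])
  qed
  have q_add: "q (q x \<oplus>\<^bsub>N\<^esub> q y) = q (x \<oplus>\<^bsub>N\<^esub> y)" if "x \<in> carrier N" "y \<in> carrier N" for x y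
  proof (rule q_eqI)
    have "(q x \<oplus>\<^bsub>N\<^esub> q y) \<ominus>\<^bsub>N\<^esub> (x \<oplus>\<^bsub>N\<^esub> y) = (q x \<ominus>\<^bsub>N\<^esub> x) \<oplus>\<^bsub>N\<^esub> (q y \<ominus>\<^bsub>N\<^esub> y)"
      using that q by (simp add: a_minus_def N.minus_add N.a_ac)
    then show "(q x \<oplus>\<^bsub>N\<^esub> q y) \<ominus>\<^bsub>N\<^esub> (x \<oplus>\<^bsub>N\<^esub> y) \<in> K"
      using that q(2) K.m_closed by simp
  qed (use that q in auto)
  have q_smult: "q (a \<odot>\<^bsub>N\<^esub> q x) = q (a \<odot>\<^bsub>N\<^esub> x)" if "a \<in> carrier R" "x \<in> carrier N" for a x
  proof (rule q_eqI)
    have "a \<odot>\<^bsub>N\<^esub> q x \<ominus>\<^bsub>N\<^esub> a \<odot>\<^bsub>N\<^esub> x = a \<odot>\<^bsub>N\<^esub> (q x \<ominus>\<^bsub>N\<^esub> x)"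
      using that q by (simp add: a_minus_def N.smult_r_distr N.smult_uminus)
    then show "a \<odot>\<^bsub>N\<^esub> q x \<ominus>\<^bsub>N\<^esub> a \<odot>\<^bsub>N\<^esub> x \<in> K"
      using that q K.smult_closed by simp
  qed (use that q in auto)
  have q_idem: "q (q x) = q x" if "x \<in> carrier N" for x
    using that q by (intro q_eqI) auto
  define Q :: "('r, 'u) module" where "Q =
    \<lparr>carrier = q ` carrier N, mult = (\<lambda>x y. x), one = undefined, zero = q \<zero>\<^bsub>N\<^esub>,
     add = (\<lambda>x y. q (x \<oplus>\<^bsub>N\<^esub> y)), smult = (\<lambda>a x. q (a \<odot>\<^bsub>N\<^esub> x))\<rparr>"
  have Q [simp]: "carrier Q = q ` carrier N" "\<zero>\<^bsub>Q\<^esub> = q \<zero>\<^bsub>N\<^esub>"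
    "x \<oplus>\<^bsub>Q\<^esub> y = q (x \<oplus>\<^bsub>N\<^esub> y)" "a \<odot>\<^bsub>Q\<^esub> x = q (a \<odot>\<^bsub>N\<^esub> x)" for x y a
    by (simp_all add: Q_def)
  have "abelian_group Q"
  proof (rule abelian_groupI)
    fix x assume "x \<in> carrier Q"
    then obtain u where u: "u \<in> carrier N" "x = q u" by auto
    have "q (\<ominus>\<^bsub>N\<^esub> u) \<oplus>\<^bsub>Q\<^esub> x = \<zero>\<^bsub>Q\<^esub>"
      using u by (simp add: q_add N.l_neg)
    then show "\<exists>y\<in>carrier Q. y \<oplus>\<^bsub>Q\<^esub> x = \<zero>\<^bsub>Q\<^esub>"
      using u by (metis Q(1) N.a_inv_closed imageI)
  next
    fix x y z assume "x \<in> carrier Q" "y \<in> carrier Q" "z \<in> carrier Q"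
    then obtain u v w where u: "u \<in> carrier N" "x = q u" "v \<in> carrier N" "y = q v"
      "w \<in> carrier N" "z = q w" by auto
    have "q (q (u \<oplus>\<^bsub>N\<^esub> v) \<oplus>\<^bsub>N\<^esub> q w) = q (q u \<oplus>\<^bsub>N\<^esub> q (v \<oplus>\<^bsub>N\<^esub> w))"
      using u by (simp only: q_add N.a_closed N.a_assoc)
    then show "x \<oplus>\<^bsub>Q\<^esub> y \<oplus>\<^bsub>Q\<^esub> z = x \<oplus>\<^bsub>Q\<^esub> (y \<oplus>\<^bsub>Q\<^esub> z)"
      using u by (simp add: q_add)
  qed (use q_add[of "\<zero>\<^bsub>N\<^esub>"] q in \<open>auto simp: N.a_comm q_add\<close>)
  then have "left_module R Q"
  proof (intro left_module.intro left_module_axioms.intro N.R.ring_axioms)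
    fix a x assume "a \<in> carrier R" "x \<in> carrier Q"
    then show "a \<odot>\<^bsub>Q\<^esub> x \<in> carrier Q" using q by auto
  next
    fix a b x assume ab: "a \<in> carrier R" "b \<in> carrier R" and "x \<in> carrier Q"
    then obtain u where u: "u \<in> carrier N" "x = q u" by auto
    show "(a \<oplus>\<^bsub>R\<^esub> b) \<odot>\<^bsub>Q\<^esub> x = a \<odot>\<^bsub>Q\<^esub> x \<oplus>\<^bsub>Q\<^esub> b \<odot>\<^bsub>Q\<^esub> x"
      using ab u q by (simp add: q_smult q_add) (simp add: N.smult_l_distr)
    show "(a \<otimes>\<^bsub>R\<^esub> b) \<odot>\<^bsub>Q\<^esub> x = a \<odot>\<^bsub>Q\<^esub> (b \<odot>\<^bsub>Q\<^esub> x)"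
      using ab u q by (simp add: q_smult) (simp add: N.smult_assoc1)
  next
    fix a x y assume a: "a \<in> carrier R" and "x \<in> carrier Q" "y \<in> carrier Q"
    then obtain u v where u: "u \<in> carrier N" "x = q u" "v \<in> carrier N" "y = q v" by auto
    show "a \<odot>\<^bsub>Q\<^esub> (x \<oplus>\<^bsub>Q\<^esub> y) = a \<odot>\<^bsub>Q\<^esub> x \<oplus>\<^bsub>Q\<^esub> a \<odot>\<^bsub>Q\<^esub> y"
      using a u q by (simp add: q_smult q_add) (simp add: N.smult_r_distr)
  next
    fix x assume "x \<in> carrier Q"
    then show "\<one>\<^bsub>R\<^esub> \<odot>\<^bsub>Q\<^esub> x = x" using q by (auto simp: q_idem)
  qed
  moreover have "small (carrier Q)"
    using assms(1) by (simp add: small_module_def small_image)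
  ultimately have "small_module R Q"
    by (simp add: small_module_def)
  moreover have "q \<in> extensional (carrier N)"
    by (simp add: q_def)
  then have "q \<in> module_homs R N Q"
    using q by (intro module_homsI) (simp_all add: q_add q_smult)
  moreover have "{x \<in> carrier N. q x = \<zero>\<^bsub>Q\<^esub>} = K"
  proof (intro equalityI subsetI)
    fix x assume x: "x \<in> {x \<in> carrier N. q x = \<zero>\<^bsub>Q\<^esub>}"
    then have "q \<zero>\<^bsub>N\<^esub> \<in> K" "q x \<ominus>\<^bsub>N\<^esub> x \<in> K" "q x = q \<zero>\<^bsub>N\<^esub>"
      using q(2)[of "\<zero>\<^bsub>N\<^esub>"] q(1)[of "\<zero>\<^bsub>N\<^esub>"] q(2)[of x] by (auto simp: a_minus_def minus_zero)
    moreover have "q x \<oplus>\<^bsub>N\<^esub> \<ominus>\<^bsub>N\<^esub> (q x \<ominus>\<^bsub>N\<^esub> x) = x"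
      using x q(1)[of x] by (simp add: a_minus_def N.minus_add N.r_neg1 N.r_neg2)
    ultimately show "x \<in> K"
      using K.m_closed[of "q x" "\<ominus>\<^bsub>N\<^esub> (q x \<ominus>\<^bsub>N\<^esub> x)"] Kneg by simp
  next
    fix x assume "x \<in> K"
    then show "x \<in> {x \<in> carrier N. q x = \<zero>\<^bsub>Q\<^esub>}"
      using Kc q_eqI[of x "\<zero>\<^bsub>N\<^esub>"] by (simp add: a_minus_def minus_zero)
  qed
  ultimately show thesis by (rule that)
qed

lemma product_cone_ext:
  assumes "product_cone R I Q P p" "x \<in> carrier P" "y \<in> carrier P"
    and "\<And>i. i \<in> I \<Longrightarrow> p i x = p i y"
  shows "x = y"
proof -
  have "inj_on (\<lambda>x. \<lambda>i\<in>I. p i x) (carrier P)"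
    using assms(1) by (simp add: product_cone_def bij_betw_def)
  then show ?thesis
    using assms(2-4) by (auto simp: inj_on_def intro!: restrict_ext)
qed

text \<open>
  The universal property of the product: a product cone is only given through the bijection of its
  carrier with the families, so the lift is defined by inverting that bijection, and it is a
  homomorphism because its composites with the projections are.
\<close>

lemma product_cone_lift:
  assumes "left_module R N" "\<And>i. i \<in> I \<Longrightarrow> left_module R (Q i)"
    and "product_cone R I Q P p"
    and "\<And>i. i \<in> I \<Longrightarrow> q i \<in> module_homs R N (Q i)"
  obtains h where "h \<in> module_homs R N P"
    and "\<And>i. i \<in> I \<Longrightarrow> compose (carrier N) (p i) h = q i"
proof -
  interpret N: left_module R N by fact
  have bij: "bij_betw (\<lambda>x. \<lambda>i\<in>I. p i x) (carrier P) (\<Pi>\<^sub>E i\<in>I. carrier (Q i))"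
    and p: "\<And>i. i \<in> I \<Longrightarrow> p i \<in> module_homs R P (Q i)"
    and "small_module R P"
    using assms(3) by (auto simp: product_cone_def)
  then interpret P: left_module R P by (simp add: small_module_imp_left_module)
  have P_ext: "x = y" if "x \<in> carrier P" "y \<in> carrier P" "\<And>i. i \<in> I \<Longrightarrow> p i x = p i y" for x y
    using bij_betw_imp_inj_on[OF bij] that by (auto simp: inj_on_def intro!: restrict_ext)
  define h where "h = (\<lambda>x\<in>carrier N. inv_into (carrier P) (\<lambda>x. \<lambda>i\<in>I. p i x) (\<lambda>i\<in>I. q i x))"
  have h: "h x \<in> carrier P" "\<And>i. i \<in> I \<Longrightarrow> p i (h x) = q i x" if x: "x \<in> carrier N" for x
  proof -
    have fam: "(\<lambda>i\<in>I. q i x) \<in> (\<lambda>x. \<lambda>i\<in>I. p i x) ` carrier P"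
      using module_homsD(2)[OF assms(4) x] bij by (auto simp: bij_betw_def)
    show "h x \<in> carrier P"
      using inv_into_into[OF fam] x by (simp add: h_def)
    show "p i (h x) = q i x" if "i \<in> I" for i
      using fun_cong[OF f_inv_into_f[OF fam], of i] x that by (simp add: h_def)
  qed
  have "h \<in> module_homs R N P"
  proof (rule module_homsI)
    show "h (x \<oplus>\<^bsub>N\<^esub> y) = h x \<oplus>\<^bsub>P\<^esub> h y" if "x \<in> carrier N" "y \<in> carrier N" for x y
      by (rule P_ext) (use that h module_homsD(3)[OF p] module_homsD(3)[OF assms(4)] in auto)
    show "h (a \<odot>\<^bsub>N\<^esub> x) = a \<odot>\<^bsub>P\<^esub> h x" if "a \<in> carrier R" "x \<in> carrier N" for a x
      by (rule P_ext) (use that h module_homsD(4)[OF p] module_homsD(4)[OF assms(4)] in auto)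
  qed (use h in \<open>auto simp: h_def\<close>)
  moreover have "compose (carrier N) (p i) h = q i" if "i \<in> I" for i
    using module_homsD(1)[OF assms(4)[OF that]] h that
    by (auto simp: compose_def extensional_def fun_eq_iff)
  ultimately show thesis by (rule that)
qed

section \<open>Functors on small modules\<close>

locale module_functor =
  fixes R :: "'r ring" and M :: "('r, 'u::universe, 'm) rfun"
  assumes ring: "ring R" and functorial: "R_functor R M"
begin

lemma value_group: "small_module R N \<Longrightarrow> comm_group (fobj M N)"
  using functorial by (simp add: R_functor_def)

lemma value_is_group: "small_module R N \<Longrightarrow> group (fobj M N)"
  by (simp add: value_group comm_group.axioms)

lemma arr_hom:
  "small_module R N \<Longrightarrow> small_module R P \<Longrightarrow> f \<in> module_homs R N P
    \<Longrightarrow> farr M N P f \<in> hom (fobj M N) (fobj M P)"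
  using functorial by (simp add: R_functor_def)

lemma arr_closed:
  "small_module R N \<Longrightarrow> small_module R P \<Longrightarrow> f \<in> module_homs R N P \<Longrightarrow> m \<in> carrier (fobj M N)
    \<Longrightarrow> farr M N P f m \<in> carrier (fobj M P)"
  using arr_hom by (auto simp: hom_def)

lemma arr_mult:
  "small_module R N \<Longrightarrow> small_module R P \<Longrightarrow> f \<in> module_homs R N P
    \<Longrightarrow> m \<in> carrier (fobj M N) \<Longrightarrow> m' \<in> carrier (fobj M N)
    \<Longrightarrow> farr M N P f (m \<otimes>\<^bsub>fobj M N\<^esub> m') = farr M N P f m \<otimes>\<^bsub>fobj M P\<^esub> farr M N P f m'"
  using arr_hom by (auto simp: hom_def)

lemma arr_one:
  "small_module R N \<Longrightarrow> small_module R P \<Longrightarrow> f \<in> module_homs R N P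
    \<Longrightarrow> farr M N P f \<one>\<^bsub>fobj M N\<^esub> = \<one>\<^bsub>fobj M P\<^esub>"
  using arr_hom value_is_group by (blast intro: hom_one)

lemma arr_id:
  "small_module R N \<Longrightarrow> m \<in> carrier (fobj M N) \<Longrightarrow> farr M N N (\<lambda>x\<in>carrier N. x) m = m"
  using functorial by (simp add: R_functor_def)

lemma arr_comp:
  assumes "small_module R N" "small_module R P" "small_module R Q"
    and "f \<in> module_homs R N P" "g \<in> module_homs R P Q" "m \<in> carrier (fobj M N)"
  shows "farr M P Q g (farr M N P f m) = farr M N Q (compose (carrier N) g f) m"
  using functorial assms unfolding R_functor_def by metis

lemma arr_add:
  assumes "small_module R N" "small_module R P"
    and "f \<in> module_homs R N P" "g \<in> module_homs R N P" "m \<in> carrier (fobj M N)"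
  shows "farr M N P (\<lambda>x\<in>carrier N. f x \<oplus>\<^bsub>P\<^esub> g x) m = farr M N P f m \<otimes>\<^bsub>fobj M P\<^esub> farr M N P g m"
proof -
  have "farr M N P (f \<otimes>\<^bsub>Hom_group R N P\<^esub> g) m = farr M N P f m \<otimes>\<^bsub>fobj M P\<^esub> farr M N P g m"
    using functorial assms by (simp add: R_functor_def)
  then show ?thesis by (simp add: Hom_group_def)
qed

lemma arr_zero:
  assumes N: "small_module R N" and P: "small_module R P" and m: "m \<in> carrier (fobj M N)"
  shows "farr M N P (\<lambda>x\<in>carrier N. \<zero>\<^bsub>P\<^esub>) m = \<one>\<^bsub>fobj M P\<^esub>"
proof -
  interpret P: left_module R P using P by (rule small_module_imp_left_module)
  interpret G: group "fobj M P" using P by (rule value_is_group)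
  let ?z = "\<lambda>x\<in>carrier N. \<zero>\<^bsub>P\<^esub>"
  have z: "?z \<in> module_homs R N P"
    using N P by (intro zero_hom small_module_imp_left_module)
  have "(\<lambda>x\<in>carrier N. ?z x \<oplus>\<^bsub>P\<^esub> ?z x) = ?z"
    by (intro restrict_ext) simp
  then have "farr M N P ?z m \<otimes>\<^bsub>fobj M P\<^esub> farr M N P ?z m = farr M N P ?z m"
    using arr_add[OF N P z z m] by simp
  then show ?thesis
    using arr_closed[OF N P z m] by (metis G.l_cancel_one)
qed

section \<open>Submodule schemes and their generators\<close>

text \<open>
  The image of the morphism that corresponds to \<open>s \<in> M(N)\<close> under the Yoneda lemma.
\<close>

definition scheme_image :: "('r, 'u) module \<Rightarrow> 'm \<Rightarrow> ('r, 'u) module \<Rightarrow> 'm set"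
  where "scheme_image N s P = (\<lambda>f. farr M N P f s) ` module_homs R N P"

text \<open>
  The elements for which this morphism is a monomorphism.
\<close>

definition mono_element :: "('r, 'u) module \<Rightarrow> 'm \<Rightarrow> bool"
  where "mono_element N s \<longleftrightarrow> small_module R N \<and> s \<in> carrier (fobj M N) \<and>
    (\<forall>P. small_module R P \<longrightarrow> inj_on (\<lambda>f. farr M N P f s) (module_homs R N P))"

text \<open>
  By additivity it is enough that the kernel is trivial: if \<open>f\<close> and \<open>g\<close> agree on \<open>s\<close>, then
  \<open>M(f - g)\<close> sends \<open>s\<close> to the neutral element.
\<close>

lemma mono_elementI:
  assumes N: "small_module R N" and s: "s \<in> carrier (fobj M N)"
    and triv: "\<And>P f x. small_module R P \<Longrightarrow> f \<in> module_homs R N P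
      \<Longrightarrow> farr M N P f s = \<one>\<^bsub>fobj M P\<^esub> \<Longrightarrow> x \<in> carrier N \<Longrightarrow> f x = \<zero>\<^bsub>P\<^esub>"
  shows "mono_element N s"
  unfolding mono_element_def
proof (intro conjI allI impI inj_onI N s)
  fix P f g
  assume P: "small_module R P" and f: "f \<in> module_homs R N P" and g: "g \<in> module_homs R N P"
    and eq: "farr M N P f s = farr M N P g s"
  have LN: "left_module R N" and LP: "left_module R P"
    using N P by (simp_all add: small_module_imp_left_module)
  interpret P: left_module R P by fact
  interpret G: group "fobj M P" using P by (rule value_is_group)
  let ?n = "\<lambda>x\<in>carrier N. \<ominus>\<^bsub>P\<^esub> g x"
  let ?d = "\<lambda>x\<in>carrier N. f x \<oplus>\<^bsub>P\<^esub> ?n x"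
  have n: "?n \<in> module_homs R N P" using LN LP g by (rule uminus_hom)
  have d: "?d \<in> module_homs R N P" using LN LP f n by (rule add_hom)
  have "(\<lambda>x\<in>carrier N. ?d x \<oplus>\<^bsub>P\<^esub> g x) = f"
    using module_homsD[OF f] module_homsD(2)[OF g]
    by (auto simp: extensional_def fun_eq_iff P.a_assoc P.l_neg)
  then have "farr M N P ?d s \<otimes>\<^bsub>fobj M P\<^esub> farr M N P g s = farr M N P g s"
    using arr_add[OF N P d g s] eq by simp
  then have "farr M N P ?d s = \<one>\<^bsub>fobj M P\<^esub>"
    using arr_closed[OF N P d s] arr_closed[OF N P g s] by (metis G.r_cancel_one)
  then have *: "f x \<oplus>\<^bsub>P\<^esub> \<ominus>\<^bsub>P\<^esub> g x = \<zero>\<^bsub>P\<^esub>" if "x \<in> carrier N" for x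
    using triv[OF P d _ that] that by simp
  show "f = g"
  proof (rule module_hom_ext[OF f g])
    fix x assume x: "x \<in> carrier N"
    have "f x = \<ominus>\<^bsub>P\<^esub> (\<ominus>\<^bsub>P\<^esub> g x)"
      using *[OF x] x module_homsD(2)[OF f] module_homsD(2)[OF g]
      by (metis P.minus_equality P.a_inv_closed)
    then show "f x = g x"
      using x module_homsD(2)[OF g] by (simp add: P.minus_minus)
  qed
qed

lemma R_submodule_arr:
  assumes "R_submodule R M S" "small_module R N" "small_module R P"
    and "f \<in> module_homs R N P" "m \<in> S N"
  shows "farr M N P f m \<in> S P"
  using assms unfolding R_submodule_def by blast

lemma scheme_image_least:
  assumes "R_submodule R M S" "small_module R N" "s \<in> S N" "small_module R P"
  shows "scheme_image N s P \<subseteq> S P"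
  using R_submodule_arr[OF assms(1,2,4) _ assms(3)] by (auto simp: scheme_image_def)

lemma scheme_image_R_submodule:
  assumes N: "small_module R N" and s: "s \<in> carrier (fobj M N)"
  shows "R_submodule R M (scheme_image N s)"
  unfolding R_submodule_def
proof (intro conjI allI impI ballI)
  have LN: "left_module R N"
    using N by (rule small_module_imp_left_module)
  fix P :: "('r, 'u) module" assume P: "small_module R P"
  have LP: "left_module R P"
    using P by (rule small_module_imp_left_module)
  interpret P: left_module R P by fact
  interpret G: group "fobj M P" using P by (rule value_is_group)
  show "subgroup (scheme_image N s P) (fobj M P)"
  proof (rule G.subgroupI)
    show "scheme_image N s P \<subseteq> carrier (fobj M P)"
      using arr_closed[OF N P _ s] by (auto simp: scheme_image_def)
    show "scheme_image N s P \<noteq> {}"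
      using zero_hom[OF LN LP] by (auto simp: scheme_image_def)
  next
    fix a assume "a \<in> scheme_image N s P"
    then obtain f where f: "f \<in> module_homs R N P" "a = farr M N P f s"
      by (auto simp: scheme_image_def)
    let ?n = "\<lambda>x\<in>carrier N. \<ominus>\<^bsub>P\<^esub> f x"
    have n: "?n \<in> module_homs R N P" using LN LP f(1) by (rule uminus_hom)
    have "(\<lambda>x\<in>carrier N. ?n x \<oplus>\<^bsub>P\<^esub> f x) = (\<lambda>x\<in>carrier N. \<zero>\<^bsub>P\<^esub>)"
      using module_homsD(2)[OF f(1)] by (intro restrict_ext) (simp add: P.l_neg)
    then have "farr M N P ?n s \<otimes>\<^bsub>fobj M P\<^esub> a = \<one>\<^bsub>fobj M P\<^esub>"
      using arr_add[OF N P n f(1) s] arr_zero[OF N P s] f(2) by simp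
    then have "inv\<^bsub>fobj M P\<^esub> a = farr M N P ?n s"
      using arr_closed[OF N P f(1) s] arr_closed[OF N P n s] f(2) by (intro G.inv_equality) auto
    then show "inv\<^bsub>fobj M P\<^esub> a \<in> scheme_image N s P"
      using n by (auto simp: scheme_image_def)
  next
    fix a b assume "a \<in> scheme_image N s P" "b \<in> scheme_image N s P"
    then show "a \<otimes>\<^bsub>fobj M P\<^esub> b \<in> scheme_image N s P"
      using arr_add[OF N P _ _ s, symmetric] add_hom[OF LN LP]
      by (auto simp: scheme_image_def)
  qed
next
  fix P Q :: "('r, 'u) module" and f assume P: "small_module R P" and Q: "small_module R Q" and f: "f \<in> module_homs R P Q"
  show "farr M P Q f ` scheme_image N s P \<subseteq> scheme_image N s Q"
    using arr_comp[OF N P Q _ f s] compose_hom[OF small_module_imp_left_module[OF N] _ f]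
    by (auto simp: scheme_image_def)
qed

text \<open>
  The isomorphism sends \<open>M(f)(s)\<close> to \<open>f\<close>.
\<close>

lemma mono_element_submodule_scheme:
  assumes "mono_element N s"
  shows "submodule_scheme R M (scheme_image N s)"
proof -
  have N: "small_module R N" and s: "s \<in> carrier (fobj M N)"
    and inj: "\<And>P. small_module R P \<Longrightarrow> inj_on (\<lambda>f. farr M N P f s) (module_homs R N P)"
    using assms by (auto simp: mono_element_def)
  have LN: "left_module R N"
    using N by (rule small_module_imp_left_module)
  define \<eta> where "\<eta> P = inv_into (module_homs R N P) (\<lambda>f. farr M N P f s)" for P
  have \<eta>: "\<eta> P (farr M N P f s) = f" if "small_module R P" "f \<in> module_homs R N P" for P f
    using inv_into_f_f[OF inj] that by (simp add: \<eta>_def)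
  have "\<eta> P \<in> iso (fobj (restrict_functor M (scheme_image N s)) P) (fobj (module_scheme R N) P)"
    if P: "small_module R P" for P
  proof (rule isoI)
    have LP: "left_module R P"
      using P by (rule small_module_imp_left_module)
    show "\<eta> P \<in> hom (fobj (restrict_functor M (scheme_image N s)) P) (fobj (module_scheme R N) P)"
      using \<eta>[OF P] arr_add[OF N P _ _ s, symmetric] add_hom[OF LN LP]
      by (auto simp: hom_def restrict_functor_def module_scheme_def Hom_group_def scheme_image_def)
    have "bij_betw (\<eta> P) (scheme_image N s P) (module_homs R N P)"
      unfolding \<eta>_def scheme_image_def by (intro bij_betw_inv_into inj_on_imp_bij_betw inj P)
    then show "bij_betw (\<eta> P) (carrier (fobj (restrict_functor M (scheme_image N s)) P))
        (carrier (fobj (module_scheme R N) P))"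
      by (simp add: restrict_functor_def module_scheme_def Hom_group_def)
  qed
  moreover from this have "R_morphism R (restrict_functor M (scheme_image N s)) (module_scheme R N) \<eta>"
    unfolding R_morphism_def
  proof (intro conjI allI impI ballI)
    fix P Q :: "('r, 'u) module" and f m
    assume P: "small_module R P" and Q: "small_module R Q" and f: "f \<in> module_homs R P Q"
      and "m \<in> carrier (fobj (restrict_functor M (scheme_image N s)) P)"
    then obtain g where g: "g \<in> module_homs R N P" "m = farr M N P g s"
      by (auto simp: restrict_functor_def scheme_image_def)
    show "\<eta> Q (farr (restrict_functor M (scheme_image N s)) P Q f m)
        = farr (module_scheme R N) P Q f (\<eta> P m)"
      using arr_comp[OF N P Q g(1) f s] \<eta>[OF P g(1)] \<eta>[OF Q compose_hom[OF LN g(1) f]] g(2)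
      by (simp add: restrict_functor_def module_scheme_def)
  qed (auto simp: iso_def)
  ultimately show ?thesis
    using N scheme_image_R_submodule[OF N s] by (auto simp: submodule_scheme_def R_isomorphic_def)
qed

text \<open>
  The generator is the element that an isomorphism with the module scheme of \<open>N\<close> takes to the
  identity of \<open>N\<close>.
\<close>

lemma submodule_scheme_generator:
  assumes "submodule_scheme R M S"
  obtains N s where "mono_element N s"
    and "\<And>P. small_module R P \<Longrightarrow> S P = scheme_image N s P"
proof -
  from assms obtain N \<eta> where sub: "R_submodule R M S" and N: "small_module R N"
    and mor: "R_morphism R (restrict_functor M S) (module_scheme R N) \<eta>"
    and iso: "\<And>P. small_module R P
      \<Longrightarrow> \<eta> P \<in> iso (fobj (restrict_functor M S) P) (fobj (module_scheme R N) P)"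
    unfolding submodule_scheme_def R_isomorphic_def by blast
  have bij: "bij_betw (\<eta> P) (S P) (module_homs R N P)" if "small_module R P" for P
    using iso[OF that] by (simp add: iso_def restrict_functor_def module_scheme_def Hom_group_def)
  have nat: "\<eta> Q (farr M P Q f m) = compose (carrier N) f (\<eta> P m)"
    if "small_module R P" "small_module R Q" "f \<in> module_homs R P Q" "m \<in> S P" for P Q f m
    using mor that by (simp add: R_morphism_def restrict_functor_def module_scheme_def)
  have "(\<lambda>x\<in>carrier N. x) \<in> \<eta> N ` S N"
    using identity_hom[OF small_module_imp_left_module[OF N]] bij[OF N] by (simp add: bij_betw_def)
  then obtain s where s: "s \<in> S N" "\<eta> N s = (\<lambda>x\<in>carrier N. x)"
    by auto
  have sM: "s \<in> carrier (fobj M N)"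
    using s(1) sub N by (auto simp: R_submodule_def dest: subgroup.subset)
  have \<eta>: "\<eta> P (farr M N P f s) = f" if "small_module R P" "f \<in> module_homs R N P" for P f
    using nat[OF N that s(1)] s(2) module_homsD(1)[OF that(2)]
    by (auto simp: compose_def extensional_def fun_eq_iff)
  have inS: "farr M N P f s \<in> S P" if "small_module R P" "f \<in> module_homs R N P" for P f
    using R_submodule_arr[OF sub N that s(1)] .
  have "mono_element N s"
    unfolding mono_element_def using N sM \<eta> by (auto intro: inj_on_inverseI)
  moreover have "S P = scheme_image N s P" if P: "small_module R P" for P
  proof (intro equalityI subsetI)
    fix m assume m: "m \<in> S P"
    then have h: "\<eta> P m \<in> module_homs R N P"
      using bij[OF P] by (auto simp: bij_betw_def)
    have "\<eta> P (farr M N P (\<eta> P m) s) = \<eta> P m"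
      using \<eta>[OF P h] .
    then have "farr M N P (\<eta> P m) s = m"
      using bij[OF P] m inS[OF P h] unfolding bij_betw_def by (blast dest: inj_onD)
    then show "m \<in> scheme_image N s P"
      using h by (force simp: scheme_image_def)
  qed (use inS[OF P] in \<open>auto simp: scheme_image_def\<close>)
  ultimately show thesis
    using that by blast
qed

text \<open>
  The factorization property of the theorem, stated for elements instead of morphisms.
\<close>

definition covered_by_schemes :: bool
  where "covered_by_schemes \<longleftrightarrow>
    (\<forall>N m. small_module R N \<longrightarrow> m \<in> carrier (fobj M N) \<longrightarrow> (\<exists>S. submodule_scheme R M S \<and> m \<in> S N))"

text \<open>
  An element \<open>m \<in> M(N)\<close> lies in \<open>S(N)\<close> if and only if the morphism \<open>f \<mapsto> M(f)(m)\<close> factors through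
  \<open>S\<close>; every morphism from the module scheme of \<open>N\<close> has this form, with \<open>m\<close> the image of the identity.
\<close>

lemma factorization_iff_covered:
  "(\<forall>N \<eta>. small_module R N \<longrightarrow> R_morphism R (module_scheme R N) M \<eta> \<longrightarrow>
      (\<exists>S. submodule_scheme R M S \<and> factors_through R (module_scheme R N) M \<eta> S))
    \<longleftrightarrow> covered_by_schemes"
proof
  assume fac: "\<forall>N \<eta>. small_module R N \<longrightarrow> R_morphism R (module_scheme R N) M \<eta> \<longrightarrow>
      (\<exists>S. submodule_scheme R M S \<and> factors_through R (module_scheme R N) M \<eta> S)"
  show covered_by_schemes
    unfolding covered_by_schemes_def
  proof (intro allI impI)
    fix N m assume N: "small_module R N" and m: "m \<in> carrier (fobj M N)"
    have LN: "left_module R N"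
      using N by (rule small_module_imp_left_module)
    let ?\<eta> = "\<lambda>P f. farr M N P f m"
    have "R_morphism R (module_scheme R N) M ?\<eta>"
      using arr_add[OF N _ _ _ m] arr_comp[OF N _ _ _ _ m] arr_closed[OF N _ _ m]
      by (auto simp: R_morphism_def hom_def module_scheme_def Hom_group_def)
    then obtain S \<theta> where S: "submodule_scheme R M S"
      and \<theta>: "R_morphism R (module_scheme R N) (restrict_functor M S) \<theta>"
      and eq: "\<And>P f. small_module R P \<Longrightarrow> f \<in> carrier (fobj (module_scheme R N) P) \<Longrightarrow> ?\<eta> P f = \<theta> P f"
      using fac N unfolding factors_through_def by blast
    have id: "(\<lambda>x\<in>carrier N. x) \<in> carrier (fobj (module_scheme R N) N)"
      using identity_hom[OF LN] by (simp add: module_scheme_def Hom_group_def)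
    have "\<theta> N (\<lambda>x\<in>carrier N. x) \<in> S N"
      using \<theta> N id by (auto simp: R_morphism_def hom_def restrict_functor_def)
    then show "\<exists>S. submodule_scheme R M S \<and> m \<in> S N"
      using S eq[OF N id] arr_id[OF N m] by auto
  qed
next
  assume cov: covered_by_schemes
  show "\<forall>N \<eta>. small_module R N \<longrightarrow> R_morphism R (module_scheme R N) M \<eta> \<longrightarrow>
      (\<exists>S. submodule_scheme R M S \<and> factors_through R (module_scheme R N) M \<eta> S)"
  proof (intro allI impI)
    fix N \<eta> assume N: "small_module R N" and \<eta>: "R_morphism R (module_scheme R N) M \<eta>"
    let ?id = "\<lambda>x\<in>carrier N. x"
    have id: "?id \<in> module_homs R N N"
      using N by (intro identity_hom small_module_imp_left_module)
    have hom: "\<eta> P \<in> hom (Hom_group R N P) (fobj M P)" if "small_module R P" for P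
      using \<eta> that by (simp add: R_morphism_def module_scheme_def)
    have nat: "\<eta> Q (compose (carrier N) f g) = farr M P Q f (\<eta> P g)"
      if "small_module R P" "small_module R Q" "f \<in> module_homs R P Q" "g \<in> module_homs R N P"
      for P Q f g
      using \<eta> that by (simp add: R_morphism_def module_scheme_def Hom_group_def)
    have "\<eta> N ?id \<in> carrier (fobj M N)"
      using hom[OF N] id by (auto simp: hom_def Hom_group_def)
    then obtain S where S: "submodule_scheme R M S" "\<eta> N ?id \<in> S N"
      using cov N unfolding covered_by_schemes_def by blast
    have "\<eta> P f \<in> S P" if P: "small_module R P" and f: "f \<in> module_homs R N P" for P f
    proof -
      have "compose (carrier N) f ?id = f"
        using module_homsD(1)[OF f] by (auto simp: compose_def extensional_def fun_eq_iff)
      then have "\<eta> P f = farr M N P f (\<eta> N ?id)"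
        using nat[OF N P f id] by simp
      then show ?thesis
        using S R_submodule_arr[OF _ N P f] by (simp add: submodule_scheme_def)
    qed
    then have "R_morphism R (module_scheme R N) (restrict_functor M S) \<eta>"
      using \<eta> by (auto simp: R_morphism_def restrict_functor_def module_scheme_def Hom_group_def hom_def)
    then show "\<exists>S. submodule_scheme R M S \<and> factors_through R (module_scheme R N) M \<eta> S"
      using S(1) by (auto simp: factors_through_def)
  qed
qed

section \<open>The least support of an element\<close>

text \<open>
  The form in which left exactness is used: an element that a homomorphism kills comes from the
  kernel.
\<close>

lemma left_exact_kernel_lift:
  assumes "left_exact R M" "small_module R N" "small_module R P" "g \<in> module_homs R N P"
    and K: "K = {x \<in> carrier N. g x = \<zero>\<^bsub>P\<^esub>}"
    and "m \<in> carrier (fobj M N)" "farr M N P g m = \<one>\<^bsub>fobj M P\<^esub>"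
  obtains k where "k \<in> carrier (fobj M (N\<lparr>carrier := K\<rparr>))"
    and "farr M (N\<lparr>carrier := K\<rparr>) N (\<lambda>x\<in>K. x) k = m"
proof -
  have sub: "submodule K R N"
    unfolding K using assms(2-4) by (intro kernel_submodule small_module_imp_left_module)
  have "(\<lambda>x\<in>K. x) \<in> module_homs R (N\<lparr>carrier := K\<rparr>) N"
    using sub by (rule inclusion_hom_ambient)
  moreover have "inj_on (\<lambda>x\<in>K. x) (carrier (N\<lparr>carrier := K\<rparr>))"
    "(\<lambda>x\<in>K. x) ` carrier (N\<lparr>carrier := K\<rparr>) = {x \<in> carrier N. g x = \<zero>\<^bsub>P\<^esub>}"
    by (auto simp: inj_on_def K)
  ultimately have "farr M (N\<lparr>carrier := K\<rparr>) N (\<lambda>x\<in>K. x) ` carrier (fobj M (N\<lparr>carrier := K\<rparr>))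
      = kernel (fobj M N) (fobj M P) (farr M N P g)"
    using assms(1)[unfolded left_exact_def, rule_format,
        OF submodule_small_module[OF assms(2) sub] assms(2,3) _ assms(4)] by simp
  moreover have "m \<in> kernel (fobj M N) (fobj M P) (farr M N P g)"
    using assms(6,7) by (simp add: kernel_def)
  ultimately show thesis
    using that by (metis (no_types, lifting) imageE)
qed

text \<open>
  The scheme that contains \<open>m\<close> is generated by the preimage of \<open>m\<close> in the value at the least
  submodule of \<open>N\<close> that supports \<open>m\<close>; minimality makes this preimage monomorphic.
\<close>

lemma left_exact_Mittag_Leffler_imp_covered:
  assumes le: "left_exact R M" and inj_prod: "Mittag_Leffler R M"
  shows covered_by_schemes
  unfolding covered_by_schemes_def
proof (intro allI impI)
  fix N m assume N: "small_module R N" and m: "m \<in> carrier (fobj M N)"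
  have LN: "left_module R N" using N by (rule small_module_imp_left_module)
  interpret N: left_module R N by fact
  define incl :: "'u set \<Rightarrow> 'u \<Rightarrow> 'u" where "incl K = (\<lambda>x\<in>K. x)" for K
  define supports where "supports K \<longleftrightarrow> submodule K R N \<and>
    (\<exists>k\<in>carrier (fobj M (N\<lparr>carrier := K\<rparr>)). farr M (N\<lparr>carrier := K\<rparr>) N (incl K) k = m)" for K
  define N\<^sub>0 where "N\<^sub>0 = {x \<in> carrier N. \<forall>K. supports K \<longrightarrow> x \<in> K}"
  \<comment> \<open>One quotient for each element outside \<open>N\<^sub>0\<close> already cuts out \<open>N\<^sub>0\<close>, so the product can be
    indexed by a subset of \<open>N\<close>.\<close>
  define I where "I = carrier N - N\<^sub>0"
  have incl: "incl K \<in> module_homs R (N\<lparr>carrier := K\<rparr>) N" if "submodule K R N" for K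
    unfolding incl_def using that by (rule inclusion_hom_ambient)
  define separates where "separates x Q q K \<longleftrightarrow> small_module R Q \<and> q \<in> module_homs R N Q \<and>
      supports K \<and> x \<notin> K \<and> {y \<in> carrier N. q y = \<zero>\<^bsub>Q\<^esub>} = K"
    for x and Q :: "('r, 'u) module" and q K
  have "\<exists>Q q K. separates x Q q K" if x: "x \<in> I" for x
  proof -
    obtain K where K: "supports K" "x \<notin> K"
      using x unfolding I_def N\<^sub>0_def by blast
    then have "submodule K R N" by (simp add: supports_def)
    then obtain Q :: "('r, 'u) module" and q where "small_module R Q" "q \<in> module_homs R N Q"
      "{y \<in> carrier N. q y = \<zero>\<^bsub>Q\<^esub>} = K"
      by (rule quotient_exists[OF N])
    with K show ?thesis unfolding separates_def by blast
  qed
  then obtain Q q K where "\<And>x. x \<in> I \<Longrightarrow> separates x (Q x) (q x) (K x)"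
    by metis
  then have Q: "\<And>x. x \<in> I \<Longrightarrow> small_module R (Q x)"
    and q: "\<And>x. x \<in> I \<Longrightarrow> q x \<in> module_homs R N (Q x)"
    and K: "\<And>x. x \<in> I \<Longrightarrow> supports (K x)" "\<And>x. x \<in> I \<Longrightarrow> x \<notin> K x"
    and ker: "\<And>x. x \<in> I \<Longrightarrow> {y \<in> carrier N. q x y = \<zero>\<^bsub>Q x\<^esub>} = K x"
    unfolding separates_def by blast+
  have LQ: "left_module R (Q x)" if "x \<in> I" for x
    using Q[OF that] by (rule small_module_imp_left_module)
  have smI: "small I"
    using N by (auto simp: small_module_def I_def intro: small_subset)
  obtain P p where cone: "product_cone R I Q P p"
    using product_cone_exists[OF ring smI, of Q] Q by blast
  then have P: "small_module R P" and p: "\<And>x. x \<in> I \<Longrightarrow> p x \<in> module_homs R P (Q x)"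
    by (auto simp: product_cone_def)
  have LP: "left_module R P" using P by (rule small_module_imp_left_module)
  interpret P: left_module R P by fact
  obtain h where h: "h \<in> module_homs R N P"
    and ph: "\<And>x. x \<in> I \<Longrightarrow> compose (carrier N) (p x) h = q x"
    using product_cone_lift[where q = q, OF LN LQ cone q] by blast
  have ph': "p x (h y) = q x y" if "x \<in> I" "y \<in> carrier N" for x y
    using fun_cong[OF ph[OF that(1)], of y] that(2) by (simp add: compose_def)
  have N\<^sub>0: "N\<^sub>0 = {y \<in> carrier N. h y = \<zero>\<^bsub>P\<^esub>}"
  proof (intro equalityI subsetI)
    fix y assume y: "y \<in> N\<^sub>0"
    then have yN: "y \<in> carrier N" by (simp add: N\<^sub>0_def)
    have "h y = \<zero>\<^bsub>P\<^esub>"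
    proof (rule product_cone_ext[OF cone])
      fix x assume x: "x \<in> I"
      have "y \<in> K x" using y K(1)[OF x] by (simp add: N\<^sub>0_def)
      then have "q x y = \<zero>\<^bsub>Q x\<^esub>" using ker[OF x] by blast
      then show "p x (h y) = p x \<zero>\<^bsub>P\<^esub>"
        using ph'[OF x yN] module_hom_zero[OF LP LQ[OF x] p[OF x]] by simp
    qed (use module_homsD(2)[OF h yN] in simp_all)
    then show "y \<in> {y \<in> carrier N. h y = \<zero>\<^bsub>P\<^esub>}" using yN by simp
  next
    fix y assume "y \<in> {y \<in> carrier N. h y = \<zero>\<^bsub>P\<^esub>}"
    then have yN: "y \<in> carrier N" and hy: "h y = \<zero>\<^bsub>P\<^esub>" by auto
    show "y \<in> N\<^sub>0"
    proof (rule ccontr)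
      assume "y \<notin> N\<^sub>0"
      then have y: "y \<in> I" using yN by (simp add: I_def)
      have "q y y = \<zero>\<^bsub>Q y\<^esub>"
        using ph'[OF y yN] hy module_hom_zero[OF LP LQ[OF y] p[OF y]] by simp
      then have "y \<in> K y" using ker[OF y] yN by blast
      then show False using K(2)[OF y] by blast
    qed
  qed
  have sub\<^sub>0: "submodule N\<^sub>0 R N"
    unfolding N\<^sub>0 by (rule kernel_submodule[OF LN LP h])
  let ?A = "N\<lparr>carrier := N\<^sub>0\<rparr>"
  have A: "small_module R ?A" by (rule submodule_small_module[OF N sub\<^sub>0])
  have hm: "farr M N P h m \<in> carrier (fobj M P)" by (rule arr_closed[OF N P h m])
  have one: "\<one>\<^bsub>fobj M P\<^esub> \<in> carrier (fobj M P)"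
    using group.is_monoid[OF value_is_group[OF P]] by (rule monoid.one_closed)
  have "farr M P (Q x) (p x) (farr M N P h m) = farr M P (Q x) (p x) \<one>\<^bsub>fobj M P\<^esub>" if x: "x \<in> I" for x
  proof -
    let ?K = "N\<lparr>carrier := K x\<rparr>"
    have sub: "submodule (K x) R N" using K(1)[OF x] by (simp add: supports_def)
    have KM: "small_module R ?K" by (rule submodule_small_module[OF N sub])
    obtain k where k: "k \<in> carrier (fobj M ?K)" "farr M ?K N (incl (K x)) k = m"
      using K(1)[OF x] by (auto simp: supports_def)
    \<comment> \<open>\<open>m\<close> comes from \<open>K x\<close>, on which \<open>q x\<close> vanishes.\<close>
    have "q x y = \<zero>\<^bsub>Q x\<^esub>" if "y \<in> K x" for y
      using ker[OF x] that by blast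
    then have "compose (carrier ?K) (q x) (incl (K x)) = (\<lambda>y\<in>carrier ?K. \<zero>\<^bsub>Q x\<^esub>)"
      by (auto simp: compose_def incl_def intro!: restrict_ext)
    then have "farr M N (Q x) (q x) m = \<one>\<^bsub>fobj M (Q x)\<^esub>"
      using arr_comp[OF KM N Q[OF x] incl[OF sub] q[OF x] k(1)] arr_zero[OF KM Q[OF x] k(1)] k(2)
      by simp
    then show ?thesis
      using arr_comp[OF N P Q[OF x] h p[OF x] m] ph[OF x] arr_one[OF P Q[OF x] p[OF x]] by simp
  qed
  moreover have "inj_on (\<lambda>m. \<lambda>i\<in>I. farr M P (Q i) (p i) m) (carrier (fobj M P))"
    using inj_prod smI Q cone unfolding Mittag_Leffler_def by blast
  ultimately have "farr M N P h m = \<one>\<^bsub>fobj M P\<^esub>"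
    using hm one by (auto simp: inj_on_def intro!: restrict_ext)
  then obtain s where s: "s \<in> carrier (fobj M ?A)" "farr M ?A N (incl N\<^sub>0) s = m"
    using left_exact_kernel_lift[OF le N P h N\<^sub>0 m] by (auto simp: incl_def)
  have "mono_element ?A s"
  proof (rule mono_elementI[OF A s(1)])
    fix P' f x
    assume P': "small_module R P'" and f: "f \<in> module_homs R ?A P'"
      and fs: "farr M ?A P' f s = \<one>\<^bsub>fobj M P'\<^esub>" and x: "x \<in> carrier ?A"
    \<comment> \<open>Left exactness at \<open>N\<^sub>0 \<rightarrow> P'\<close> makes the kernel of \<open>f\<close> a support of \<open>m\<close>, so it is all of \<open>N\<^sub>0\<close>.\<close>
    define H where "H = {y \<in> carrier ?A. f y = \<zero>\<^bsub>P'\<^esub>}"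
    have subA: "submodule H R ?A"
      unfolding H_def using A P' f by (intro kernel_submodule small_module_imp_left_module)
    have sub: "submodule H R N"
      by (rule submodule_trans[OF N sub\<^sub>0 subA])
    obtain k where k: "k \<in> carrier (fobj M (?A\<lparr>carrier := H\<rparr>))"
      "farr M (?A\<lparr>carrier := H\<rparr>) ?A (incl H) k = s"
      using left_exact_kernel_lift[OF le A P' f H_def s(1) fs] by (auto simp: incl_def)
    have HA: "incl H \<in> module_homs R (N\<lparr>carrier := H\<rparr>) ?A"
      unfolding incl_def by (rule inclusion_hom[OF sub]) (auto simp: H_def)
    have "compose H (incl N\<^sub>0) (incl H) = incl H"
      by (auto simp: compose_def incl_def H_def intro!: restrict_ext)
    then have "farr M (N\<lparr>carrier := H\<rparr>) N (incl H) k = m"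
      using arr_comp[OF submodule_small_module[OF N sub] A N HA incl[OF sub\<^sub>0], of k] k s(2) by simp
    then have "supports H"
      using k(1) sub by (auto simp: supports_def)
    then have "x \<in> H" using x by (auto simp: N\<^sub>0_def)
    then show "f x = \<zero>\<^bsub>P'\<^esub>" by (simp add: H_def)
  qed
  moreover have "m \<in> scheme_image ?A s N"
    using s(2) incl[OF sub\<^sub>0] by (auto simp: scheme_image_def)
  ultimately show "\<exists>S. submodule_scheme R M S \<and> m \<in> S N"
    using mono_element_submodule_scheme by blast
qed

section \<open>Directedness and a small cofinal family\<close>

text \<open>
  A scheme that contains the sum of the generators \<open>s\<^sub>1\<close> and \<open>s\<^sub>2\<close>, taken in the value at \<open>A \<times> B\<close>,
  contains \<open>s\<^sub>1\<close> and \<open>s\<^sub>2\<close>, since submodules are closed under the two projections.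
\<close>

lemma upper_bound_scheme:
  assumes cov: covered_by_schemes
    and "submodule_scheme R M S\<^sub>1" "submodule_scheme R M S\<^sub>2"
  obtains S where "submodule_scheme R M S"
    and "\<And>N. small_module R N \<Longrightarrow> S\<^sub>1 N \<subseteq> S N \<and> S\<^sub>2 N \<subseteq> S N"
proof -
  obtain A s\<^sub>1 where mono\<^sub>1: "mono_element A s\<^sub>1"
    and S\<^sub>1: "\<And>P. small_module R P \<Longrightarrow> S\<^sub>1 P = scheme_image A s\<^sub>1 P"
    using submodule_scheme_generator[OF assms(2)] by metis
  obtain B s\<^sub>2 where mono\<^sub>2: "mono_element B s\<^sub>2"
    and S\<^sub>2: "\<And>P. small_module R P \<Longrightarrow> S\<^sub>2 P = scheme_image B s\<^sub>2 P"
    using submodule_scheme_generator[OF assms(3)] by metis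
  have N: "small_module R A" "small_module R B"
    and s: "s\<^sub>1 \<in> carrier (fobj M A)" "s\<^sub>2 \<in> carrier (fobj M B)"
    using mono\<^sub>1 mono\<^sub>2 by (auto simp: mono_element_def)
  have LN: "left_module R A" "left_module R B"
    using N by (simp_all add: small_module_imp_left_module)
  \<comment> \<open>The product of two modules needs an index set with two elements.\<close>
  obtain a b :: 'u where ab: "a \<noteq> b"
    using infinite_universe by (metis (full_types) UNIV_I ex_new_if_finite finite.emptyI finite.insertI insertI1)
  define Q where "Q i = (if i = a then A else B)" for i
  have Q: "small_module R (Q i)" and LQ: "left_module R (Q i)" for i
    using N LN by (auto simp: Q_def)
  obtain P p where cone: "product_cone R {a, b} Q P p"
    using product_cone_exists[OF ring finite_imp_small, of "{a, b}" Q] Q by blast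
  then have P: "small_module R P" and p: "p a \<in> module_homs R P A" "p b \<in> module_homs R P B"
    using ab by (auto simp: product_cone_def Q_def)
  define q\<^sub>1 where "q\<^sub>1 i = (if i = a then (\<lambda>x\<in>carrier A. x) else (\<lambda>x\<in>carrier A. \<zero>\<^bsub>B\<^esub>))" for i
  define q\<^sub>2 where "q\<^sub>2 i = (if i = a then (\<lambda>x\<in>carrier B. \<zero>\<^bsub>A\<^esub>) else (\<lambda>x\<in>carrier B. x))" for i
  have "q\<^sub>1 i \<in> module_homs R A (Q i)" "q\<^sub>2 i \<in> module_homs R B (Q i)" for i
    using LN by (auto simp: q\<^sub>1_def q\<^sub>2_def Q_def intro: identity_hom zero_hom)
  then obtain h\<^sub>1 h\<^sub>2 where h: "h\<^sub>1 \<in> module_homs R A P" "h\<^sub>2 \<in> module_homs R B P"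
    and "\<And>i. i \<in> {a, b} \<Longrightarrow> compose (carrier A) (p i) h\<^sub>1 = q\<^sub>1 i"
    and "\<And>i. i \<in> {a, b} \<Longrightarrow> compose (carrier B) (p i) h\<^sub>2 = q\<^sub>2 i"
    using product_cone_lift[OF LN(1) LQ cone, of q\<^sub>1] product_cone_lift[OF LN(2) LQ cone, of q\<^sub>2]
    by metis
  then have ph: "compose (carrier A) (p a) h\<^sub>1 = (\<lambda>x\<in>carrier A. x)"
    "compose (carrier A) (p b) h\<^sub>1 = (\<lambda>x\<in>carrier A. \<zero>\<^bsub>B\<^esub>)"
    "compose (carrier B) (p a) h\<^sub>2 = (\<lambda>x\<in>carrier B. \<zero>\<^bsub>A\<^esub>)"
    "compose (carrier B) (p b) h\<^sub>2 = (\<lambda>x\<in>carrier B. x)"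
    using ab by (auto simp: q\<^sub>1_def q\<^sub>2_def)
  interpret G\<^sub>1: group "fobj M A" using N(1) by (rule value_is_group)
  interpret G\<^sub>2: group "fobj M B" using N(2) by (rule value_is_group)
  interpret G: group "fobj M P" using P by (rule value_is_group)
  have c: "farr M A P h\<^sub>1 s\<^sub>1 \<in> carrier (fobj M P)" "farr M B P h\<^sub>2 s\<^sub>2 \<in> carrier (fobj M P)"
    using arr_closed[OF N(1) P h(1) s(1)] arr_closed[OF N(2) P h(2) s(2)] by auto
  define m where "m = farr M A P h\<^sub>1 s\<^sub>1 \<otimes>\<^bsub>fobj M P\<^esub> farr M B P h\<^sub>2 s\<^sub>2"
  have m: "m \<in> carrier (fobj M P)"
    using c by (simp add: m_def)
  have pm: "farr M P A (p a) m = s\<^sub>1" "farr M P B (p b) m = s\<^sub>2"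
    unfolding m_def arr_mult[OF P N(1) p(1) c] arr_mult[OF P N(2) p(2) c]
      arr_comp[OF N(1) P N(1) h(1) p(1) s(1)] arr_comp[OF N(2) P N(1) h(2) p(1) s(2)]
      arr_comp[OF N(1) P N(2) h(1) p(2) s(1)] arr_comp[OF N(2) P N(2) h(2) p(2) s(2)] ph
    using s arr_id[OF N(1) s(1)] arr_id[OF N(2) s(2)] arr_zero[OF N(1,2) s(1)]
      arr_zero[OF N(2,1) s(2)] by simp_all
  obtain S where S: "submodule_scheme R M S" "m \<in> S P"
    using cov P m unfolding covered_by_schemes_def by blast
  then have RS: "R_submodule R M S" by (simp add: submodule_scheme_def)
  have "s\<^sub>1 \<in> S A" "s\<^sub>2 \<in> S B"
    using R_submodule_arr[OF RS P N(1) p(1) S(2)] R_submodule_arr[OF RS P N(2) p(2) S(2)] pm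
    by auto
  then have "S\<^sub>1 N \<subseteq> S N \<and> S\<^sub>2 N \<subseteq> S N" if "small_module R N" for N
    using that S\<^sub>1 S\<^sub>2 scheme_image_least[OF RS N(1)] scheme_image_least[OF RS N(2)] by auto
  then show thesis using that S(1) by blast
qed

text \<open>
  Some scheme contains the values of \<open>\<pi>\<close> at all elements supported on \<open>F\<close>. For one summand it is a
  scheme through the value of \<open>\<pi>\<close> at the identity of \<open>W\<^sub>l\<close>; further summands are added one at a time
  by means of upper bounds.
\<close>

lemma value_at_sum_in_scheme:
  fixes W :: "'l \<Rightarrow> ('r, 'u) module"
  assumes cov: covered_by_schemes
    and W: "\<And>l. l \<in> L \<Longrightarrow> small_module R (W l)"
    and \<pi>: "R_morphism R (direct_sum L (\<lambda>l. module_scheme R (W l))) M \<pi>"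
    and "finite F" "F \<subseteq> L"
  shows "\<exists>S. submodule_scheme R M S \<and>
    (\<forall>N w. small_module R N \<longrightarrow> w \<in> carrier (sum_group L (\<lambda>l. Hom_group R (W l) N)) \<longrightarrow>
      (\<forall>l\<in>L - F. w l = \<one>\<^bsub>Hom_group R (W l) N\<^esub>) \<longrightarrow> \<pi> N w \<in> S N)"
  using assms(4,5)
proof (induction F rule: finite_induct)
  let ?H = "\<lambda>N l. Hom_group R (W l) N"
  let ?G = "\<lambda>N. sum_group L (?H N)"
  have LW: "left_module R (W l)" if "l \<in> L" for l
    using W[OF that] by (rule small_module_imp_left_module)
  have grp: "group (?H N l)" if "small_module R N" "l \<in> L" for N l
    using LW[OF that(2)] small_module_imp_left_module[OF that(1)] by (rule Hom_group_group)
  have hom: "\<pi> N \<in> hom (?G N) (fobj M N)" if "small_module R N" for N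
    using \<pi> that by (simp add: R_morphism_def direct_sum_def module_scheme_def)
  have carrier_G: "carrier (?G N)
      = {w \<in> \<Pi>\<^sub>E l\<in>L. module_homs R (W l) N. finite {l \<in> L. w l \<noteq> \<one>\<^bsub>?H N l\<^esub>}}"
    if "small_module R N" for N
    using carrier_sum_group[of L "?H N"] grp[OF that] by (simp add: Hom_group_def)
  {
    case empty
    \<comment> \<open>The empty product supplies a small module, so that the covering has a scheme at all.\<close>
    obtain P :: "('r, 'u) module" and p where "product_cone R {} undefined P p"
      using product_cone_exists[OF ring finite_imp_small, of "{}" undefined] by blast
    then have P: "small_module R P" by (simp add: product_cone_def)
    have "\<one>\<^bsub>fobj M P\<^esub> \<in> carrier (fobj M P)"
      using group.is_monoid[OF value_is_group[OF P]] by (rule monoid.one_closed)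
    then obtain S where S: "submodule_scheme R M S"
      using cov P unfolding covered_by_schemes_def by blast
    have "\<pi> N w \<in> S N" if N: "small_module R N" and w: "w \<in> carrier (?G N)"
      and triv: "\<forall>l\<in>L - {}. w l = \<one>\<^bsub>?H N l\<^esub>" for N w
    proof -
      have "w = \<one>\<^bsub>?G N\<^esub>"
        using w triv by (auto simp: carrier_G[OF N] PiE_iff extensional_def fun_eq_iff)
      then have "\<pi> N w = \<one>\<^bsub>fobj M N\<^esub>"
        using hom_one[OF hom[OF N] sum_group value_is_group[OF N]] grp[OF N] by simp
      moreover have "subgroup (S N) (fobj M N)"
        using S N by (simp add: submodule_scheme_def R_submodule_def)
      ultimately show ?thesis
        by (simp add: subgroup.one_closed)
    qed
    then show ?case using S by blast
  next
    case (insert l F)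
    then have l: "l \<in> L" by simp
    have Wl: "small_module R (W l)" using W[OF l] .
    from insert.prems have "F \<subseteq> L" by simp
    from insert.IH[OF this] obtain S\<^sub>1 where S\<^sub>1: "submodule_scheme R M S\<^sub>1"
      and in_S\<^sub>1: "\<forall>N w. small_module R N \<longrightarrow> w \<in> carrier (?G N) \<longrightarrow>
        (\<forall>i\<in>L - F. w i = \<one>\<^bsub>?H N i\<^esub>) \<longrightarrow> \<pi> N w \<in> S\<^sub>1 N"
      by (elim exE conjE)
    \<comment> \<open>The identity of \<open>W\<^sub>l\<close> in the summand \<open>l\<close>; an element \<open>e\<close> of that summand is its image under
      the homomorphism \<open>e\<^sub>l = w l\<close>.\<close>
    define u where "u = (\<lambda>i\<in>L. if i = l then (\<lambda>x\<in>carrier (W l). x) else \<one>\<^bsub>?H (W l) i\<^esub>)"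
    have "{i \<in> L. u i \<noteq> \<one>\<^bsub>?H (W l) i\<^esub>} \<subseteq> {l}"
      by (auto simp: u_def)
    then have "finite {i \<in> L. u i \<noteq> \<one>\<^bsub>?H (W l) i\<^esub>}"
      by (rule finite_subset) simp
    moreover have "u i \<in> module_homs R (W i) (W l)" if "i \<in> L" for i
      using that identity_hom[OF LW[OF l]] zero_hom[OF LW[OF that] LW[OF l]]
      by (simp add: u_def Hom_group_def)
    ultimately have u: "u \<in> carrier (?G (W l))"
      by (auto simp: carrier_G[OF Wl] u_def)
    then have "\<pi> (W l) u \<in> carrier (fobj M (W l))"
      using hom[OF Wl] by (auto simp: hom_def)
    then obtain S\<^sub>2 where S\<^sub>2: "submodule_scheme R M S\<^sub>2" "\<pi> (W l) u \<in> S\<^sub>2 (W l)"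
      using cov Wl unfolding covered_by_schemes_def by blast
    obtain S where S: "submodule_scheme R M S"
      and le: "\<And>N. small_module R N \<Longrightarrow> S\<^sub>1 N \<subseteq> S N \<and> S\<^sub>2 N \<subseteq> S N"
      using upper_bound_scheme[OF cov S\<^sub>1 S\<^sub>2(1)] by metis
    have RS: "R_submodule R M S" using S by (simp add: submodule_scheme_def)
    have "\<pi> N w \<in> S N" if N: "small_module R N" and w: "w \<in> carrier (?G N)"
      and triv: "\<forall>i\<in>L - insert l F. w i = \<one>\<^bsub>?H N i\<^esub>" for N w
    proof -
      have LN: "left_module R N" using N by (rule small_module_imp_left_module)
      have wi: "w i \<in> module_homs R (W i) N" if "i \<in> L" for i
        using w that by (auto simp: carrier_G[OF N])
      then have w_in: "w i \<in> carrier (?H N i)" if "i \<in> L" for i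
        using that by (simp add: Hom_group_def)
      have one: "\<one>\<^bsub>?H N i\<^esub> \<in> module_homs R (W i) N" if "i \<in> L" for i
        using zero_hom[OF LW[OF that] LN] by (simp add: Hom_group_def)
      have fin: "finite {i \<in> L. w i \<noteq> \<one>\<^bsub>?H N i\<^esub>}"
        using w by (simp add: carrier_G[OF N])
      define v where "v = (\<lambda>i\<in>L. if i = l then \<one>\<^bsub>?H N i\<^esub> else w i)"
      define e where "e = (\<lambda>i\<in>L. if i = l then w l else \<one>\<^bsub>?H N i\<^esub>)"
      have "finite {i \<in> L. v i \<noteq> \<one>\<^bsub>?H N i\<^esub>}" "finite {i \<in> L. e i \<noteq> \<one>\<^bsub>?H N i\<^esub>}"
        using fin by (auto simp: v_def e_def elim: rev_finite_subset)
      then have v: "v \<in> carrier (?G N)" and e: "e \<in> carrier (?G N)"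
        using wi one l by (auto simp: carrier_G[OF N] v_def e_def)
      have "w = v \<otimes>\<^bsub>?G N\<^esub> e"
      proof (rule extensionalityI[of _ L])
        fix i assume i: "i \<in> L"
        interpret H: group "?H N i" using N i by (rule grp)
        show "w i = (v \<otimes>\<^bsub>?G N\<^esub> e) i"
          using i H.l_one[of "w i"] H.r_one[of "w i"] w_in[OF i]
          by (cases "i = l") (simp_all add: v_def e_def)
      qed (use w in \<open>auto simp: carrier_G[OF N] PiE_iff\<close>)
      then have sum: "\<pi> N w = \<pi> N v \<otimes>\<^bsub>fobj M N\<^esub> \<pi> N e"
        using hom[OF N] v e by (simp add: hom_def)
      have "v i = \<one>\<^bsub>?H N i\<^esub>" if "i \<in> L - F" for i
        using that triv by (auto simp: v_def)
      then have "\<pi> N v \<in> S N"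
        using in_S\<^sub>1[rule_format, OF N v] le[OF N] by blast
      have "farr (direct_sum L (\<lambda>l. module_scheme R (W l))) (W l) N (w l) u = e"
      proof (rule extensionalityI[of _ L])
        fix i assume i: "i \<in> L"
        have "compose (carrier (W l)) (w l) (\<lambda>x\<in>carrier (W l). x) = w l"
          using module_homsD(1)[OF wi[OF l]]
          by (auto simp: compose_def extensional_def fun_eq_iff)
        moreover have "compose (carrier (W i)) (w l) (\<lambda>x\<in>carrier (W i). \<zero>\<^bsub>W l\<^esub>)
            = (\<lambda>x\<in>carrier (W i). \<zero>\<^bsub>N\<^esub>)"
          using module_hom_zero[OF LW[OF l] LN wi[OF l]]
          by (auto simp: compose_def intro!: restrict_ext)
        ultimately show "farr (direct_sum L (\<lambda>l. module_scheme R (W l))) (W l) N (w l) u i = e i"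
          using i by (auto simp: direct_sum_def module_scheme_def u_def e_def Hom_group_def)
      qed (auto simp: direct_sum_def e_def)
      moreover have "u \<in> carrier (fobj (direct_sum L (\<lambda>l. module_scheme R (W l))) (W l))"
        using u by (simp add: direct_sum_def module_scheme_def)
      ultimately have "\<pi> N e = farr M (W l) N (w l) (\<pi> (W l) u)"
        using \<pi>[unfolded R_morphism_def, THEN conjunct2, rule_format, OF Wl N wi[OF l], of u] by simp
      also have "\<dots> \<in> S N"
        using R_submodule_arr[OF RS Wl N wi[OF l]] S\<^sub>2(2) le[OF Wl] by blast
      finally have "\<pi> N e \<in> S N" .
      moreover have "subgroup (S N) (fobj M N)"
        using RS N by (simp add: R_submodule_def)
      ultimately show ?thesis
        using \<open>\<pi> N v \<in> S N\<close> unfolding sum by (blast intro: subgroup.m_closed)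
    qed
    then show ?case using S by blast
  }
qed

text \<open>
  The schemes \<open>T F\<close> that contain the image of the finite partial sum over \<open>F\<close> are cofinal among all
  submodule schemes, and the finite subsets of \<open>L\<close> can be coded by a small subset of the universe.
\<close>

lemma covered_imp_direct_limit:
  fixes W :: "'l \<Rightarrow> ('r, 'u) module"
  assumes cov: covered_by_schemes
    and L: "|L| <o |UNIV :: 'u set|"
    and W: "\<And>l. l \<in> L \<Longrightarrow> small_module R (W l)"
    and epi: "R_epimorphism R (direct_sum L (\<lambda>l. module_scheme R (W l))) M \<pi>"
  shows "direct_limit_of_submodule_schemes R M"
proof -
  have \<pi>: "R_morphism R (direct_sum L (\<lambda>l. module_scheme R (W l))) M \<pi>"
    using epi by (simp add: R_epimorphism_def)
  have "\<forall>F\<in>Fpow L. \<exists>S. submodule_scheme R M S \<and>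
    (\<forall>N w. small_module R N \<longrightarrow> w \<in> carrier (sum_group L (\<lambda>l. Hom_group R (W l) N)) \<longrightarrow>
      (\<forall>l\<in>L - F. w l = \<one>\<^bsub>Hom_group R (W l) N\<^esub>) \<longrightarrow> \<pi> N w \<in> S N)"
    using value_at_sum_in_scheme[OF cov W \<pi>] by (auto simp: Fpow_def)
  then obtain T where T: "\<And>F. F \<in> Fpow L \<Longrightarrow> submodule_scheme R M (T F)"
    and in_T: "\<And>F N w. F \<in> Fpow L \<Longrightarrow> small_module R N \<Longrightarrow> w \<in> carrier (sum_group L (\<lambda>l. Hom_group R (W l) N))
      \<Longrightarrow> \<forall>l\<in>L - F. w l = \<one>\<^bsub>Hom_group R (W l) N\<^esub> \<Longrightarrow> \<pi> N w \<in> T F N"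
    by metis
  have cofinal: "\<exists>F\<in>Fpow L. \<forall>N. small_module R N \<longrightarrow> S N \<subseteq> T F N" if S: "submodule_scheme R M S" for S
  proof -
    obtain N s where mono: "mono_element N s"
      and S_eq: "\<And>P. small_module R P \<Longrightarrow> S P = scheme_image N s P"
      using submodule_scheme_generator[OF S] by metis
    then have N: "small_module R N" and s: "s \<in> carrier (fobj M N)"
      by (auto simp: mono_element_def)
    obtain w where w: "w \<in> carrier (sum_group L (\<lambda>l. Hom_group R (W l) N))" "s = \<pi> N w"
      using epi N s by (auto simp: R_epimorphism_def direct_sum_def module_scheme_def)
    let ?F = "{l \<in> L. w l \<noteq> \<one>\<^bsub>Hom_group R (W l) N\<^esub>}"
    have "group (Hom_group R (W l) N)" if "l \<in> L" for l
      using W[OF that] N by (intro Hom_group_group small_module_imp_left_module)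
    then have F: "?F \<in> Fpow L"
      using w(1) carrier_sum_group[of L "\<lambda>l. Hom_group R (W l) N"] by (auto simp: Fpow_def)
    have "s \<in> T ?F N"
      using in_T[OF F N w(1)] w(2) by auto
    moreover have "R_submodule R M (T ?F)"
      using T[OF F] by (simp add: submodule_scheme_def)
    ultimately show ?thesis
      using F S_eq scheme_image_least[OF _ N] by blast
  qed
  obtain e :: "'l set \<Rightarrow> 'u" where e: "inj_on e (Pow L)"
    using ordLess_imp_ordLeq[OF card_Pow_universe[OF L]] by (auto simp: card_of_ordLeq[symmetric])
  have sub: "Fpow L \<subseteq> Pow L" by (auto simp: Fpow_def)
  have inv: "inv_into (Pow L) e (e F) = F" if "F \<in> Fpow L" for F
    using inv_into_f_f[OF e] that sub by blast
  define S where "S i = T (inv_into (Pow L) e i)" for i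
  have Se: "S (e F) = T F" if "F \<in> Fpow L" for F
    using inv[OF that] by (simp add: S_def)
  have "small (e ` Fpow L)"
  proof -
    have "|e ` Fpow L| \<le>o |Pow L|"
      using card_of_image[of e "Fpow L"] card_of_mono1[OF sub] ordLeq_transitive by blast
    then show ?thesis
      using ordLeq_ordLess_trans card_Pow_universe[OF L] unfolding small_def by blast
  qed
  moreover have "e ` Fpow L \<noteq> {}"
    by (auto simp: Fpow_def)
  moreover have "\<forall>i\<in>e ` Fpow L. submodule_scheme R M (S i)"
    using T Se by auto
  moreover have "\<forall>i\<in>e ` Fpow L. \<forall>j\<in>e ` Fpow L. \<exists>k\<in>e ` Fpow L. \<forall>N. small_module R N \<longrightarrow>
      S i N \<subseteq> S k N \<and> S j N \<subseteq> S k N"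
  proof (intro ballI)
    fix i j assume "i \<in> e ` Fpow L" "j \<in> e ` Fpow L"
    then have "submodule_scheme R M (S i)" "submodule_scheme R M (S j)"
      using T Se by auto
    then obtain S' where "submodule_scheme R M S'"
      and S': "\<And>N. small_module R N \<Longrightarrow> S i N \<subseteq> S' N \<and> S j N \<subseteq> S' N"
      using upper_bound_scheme[OF cov] by metis
    then obtain F where F: "F \<in> Fpow L" "\<And>N. small_module R N \<Longrightarrow> S' N \<subseteq> T F N"
      using cofinal by blast
    have "\<forall>N. small_module R N \<longrightarrow> S i N \<subseteq> S (e F) N \<and> S j N \<subseteq> S (e F) N"
      unfolding Se[OF F(1)] using S' F(2) by blast
    then show "\<exists>k\<in>e ` Fpow L. \<forall>N. small_module R N \<longrightarrow> S i N \<subseteq> S k N \<and> S j N \<subseteq> S k N"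
      using F(1) by blast
  qed
  moreover have "carrier (fobj M N) = (\<Union>i\<in>e ` Fpow L. S i N)" if N: "small_module R N" for N
  proof (intro equalityI subsetI)
    fix m assume "m \<in> carrier (fobj M N)"
    then obtain S' where "submodule_scheme R M S'" "m \<in> S' N"
      using cov N unfolding covered_by_schemes_def by blast
    then obtain F where "F \<in> Fpow L" "m \<in> T F N"
      using cofinal N by blast
    then show "m \<in> (\<Union>i\<in>e ` Fpow L. S i N)"
      using Se by auto
  next
    fix m assume "m \<in> (\<Union>i\<in>e ` Fpow L. S i N)"
    then obtain F where F: "F \<in> Fpow L" "m \<in> T F N"
      using Se by auto
    have "subgroup (T F N) (fobj M N)"
      using T[OF F(1)] N by (simp add: submodule_scheme_def R_submodule_def)
    then show "m \<in> carrier (fobj M N)"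
      using subgroup.subset F(2) by blast
  qed
  ultimately show ?thesis
    unfolding direct_limit_of_submodule_schemes_def by blast
qed

section \<open>Directed unions of submodule schemes\<close>

lemma direct_limit_imp_covered:
  "direct_limit_of_submodule_schemes R M \<Longrightarrow> covered_by_schemes"
  unfolding direct_limit_of_submodule_schemes_def covered_by_schemes_def by blast

lemma direct_limit_common_generator:
  assumes "direct_limit_of_submodule_schemes R M"
    and P: "small_module R P" and "m \<in> carrier (fobj M P)" "m' \<in> carrier (fobj M P)"
  obtains N s f f' where "mono_element N s" "f \<in> module_homs R N P" "f' \<in> module_homs R N P"
    and "m = farr M N P f s" "m' = farr M N P f' s"
proof -
  obtain I :: "'u set" and S where sch: "\<forall>i\<in>I. submodule_scheme R M (S i)"
    and dir: "\<forall>i\<in>I. \<forall>j\<in>I. \<exists>k\<in>I. \<forall>N. small_module R N \<longrightarrow> S i N \<subseteq> S k N \<and> S j N \<subseteq> S k N"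
    and un: "\<forall>N. small_module R N \<longrightarrow> carrier (fobj M N) = (\<Union>i\<in>I. S i N)"
    using assms(1) unfolding direct_limit_of_submodule_schemes_def by (elim exE conjE)
  obtain i j where "i \<in> I" "m \<in> S i P" "j \<in> I" "m' \<in> S j P"
    using un assms by auto
  moreover then obtain k where "k \<in> I" "\<forall>N. small_module R N \<longrightarrow> S i N \<subseteq> S k N \<and> S j N \<subseteq> S k N"
    using dir by blast
  ultimately obtain S where S: "submodule_scheme R M S" "m \<in> S P" "m' \<in> S P"
    using sch P by blast
  from submodule_scheme_generator[OF S(1)] obtain N s where
    "mono_element N s" "S P = scheme_image N s P"
    using P by metis
  then show thesis
    using that S(2,3) by (auto simp: scheme_image_def)
qed

text \<open>
  Two elements with the same projections are \<open>M(f)(s)\<close> and \<open>M(f')(s)\<close> for a common monomorphic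
  element \<open>s\<close>, so \<open>f\<close> and \<open>f'\<close> agree after each projection.
\<close>

lemma direct_limit_imp_Mittag_Leffler:
  assumes lim: "direct_limit_of_submodule_schemes R M"
  shows "Mittag_Leffler R M"
  unfolding Mittag_Leffler_def
proof (intro allI impI inj_onI)
  fix I :: "'u set" and Q :: "'u \<Rightarrow> ('r, 'u) module" and P p m m'
  assume Q: "\<forall>i\<in>I. small_module R (Q i)" and cone: "product_cone R I Q P p"
    and m: "m \<in> carrier (fobj M P)" "m' \<in> carrier (fobj M P)"
    and eq: "(\<lambda>i\<in>I. farr M P (Q i) (p i) m) = (\<lambda>i\<in>I. farr M P (Q i) (p i) m')"
  have P: "small_module R P" and p: "\<And>i. i \<in> I \<Longrightarrow> p i \<in> module_homs R P (Q i)"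
    using cone by (auto simp: product_cone_def)
  obtain N s f f' where mono: "mono_element N s"
    and f: "f \<in> module_homs R N P" "f' \<in> module_homs R N P"
    and m_eq: "m = farr M N P f s" "m' = farr M N P f' s"
    using direct_limit_common_generator[OF lim P m] by metis
  have N: "small_module R N" and s: "s \<in> carrier (fobj M N)"
    and inj: "\<And>P. small_module R P \<Longrightarrow> inj_on (\<lambda>f. farr M N P f s) (module_homs R N P)"
    using mono by (auto simp: mono_element_def)
  have LN: "left_module R N" using N by (rule small_module_imp_left_module)
  have "f = f'"
  proof (rule module_hom_ext[OF f])
    fix x assume x: "x \<in> carrier N"
    show "f x = f' x"
    proof (rule product_cone_ext[OF cone])
      fix i assume i: "i \<in> I"
      have Qi: "small_module R (Q i)" using Q i by blast
      have "farr M N (Q i) (compose (carrier N) (p i) f) s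
          = farr M N (Q i) (compose (carrier N) (p i) f') s"
        using fun_cong[OF eq, of i] i m_eq arr_comp[OF N P Qi f(1) p[OF i] s]
          arr_comp[OF N P Qi f(2) p[OF i] s] by simp
      then have "compose (carrier N) (p i) f = compose (carrier N) (p i) f'"
        by (rule inj_onD[OF inj[OF Qi]]) (intro compose_hom[OF LN _ p[OF i]] f)+
      then show "p i (f x) = p i (f' x)"
        using x by (metis compose_eq)
    qed (use x f in \<open>auto dest: module_homsD(2)\<close>)
  qed
  then show "m = m'" using m_eq by simp
qed

text \<open>
  Every assertion concerns at most two elements of \<open>M\<close>. Writing these as \<open>M(h)(s)\<close> with a common
  monomorphic \<open>s \<in> M(N)\<close> turns it into the same assertion for homomorphisms out of \<open>N\<close>, where it is
  the left exactness of \<open>Hom(N, -)\<close>.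
\<close>

lemma direct_limit_imp_left_exact:
  assumes lim: "direct_limit_of_submodule_schemes R M"
  shows "left_exact R M"
  unfolding left_exact_def
proof (intro allI impI ballI)
  fix A B C :: "('r, 'u) module" and f g
  assume A: "small_module R A" and B: "small_module R B" and C: "small_module R C"
    and f: "f \<in> module_homs R A B" and g: "g \<in> module_homs R B C"
    and inj_f: "inj_on f (carrier A)" and exact: "f ` carrier A = {x \<in> carrier B. g x = \<zero>\<^bsub>C\<^esub>}"
  have LA: "left_module R A" and LB: "left_module R B" and LC: "left_module R C"
    using A B C by (simp_all add: small_module_imp_left_module)
  interpret A: left_module R A by fact
  have "inj_on (farr M A B f) (carrier (fobj M A))"
  proof (rule inj_onI)
    fix m m' assume m: "m \<in> carrier (fobj M A)" "m' \<in> carrier (fobj M A)"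
      and eq: "farr M A B f m = farr M A B f m'"
    obtain N s h h' where mono: "mono_element N s"
      and h: "h \<in> module_homs R N A" "h' \<in> module_homs R N A"
      and m_eq: "m = farr M N A h s" "m' = farr M N A h' s"
      using direct_limit_common_generator[OF lim A m] by metis
    have N: "small_module R N" and s: "s \<in> carrier (fobj M N)"
      and inj: "inj_on (\<lambda>f. farr M N B f s) (module_homs R N B)"
      using mono B by (auto simp: mono_element_def)
    have LN: "left_module R N" using N by (rule small_module_imp_left_module)
    have "farr M N B (compose (carrier N) f h) s = farr M N B (compose (carrier N) f h') s"
      using eq m_eq arr_comp[OF N A B h(1) f s] arr_comp[OF N A B h(2) f s] by simp
    then have fh: "compose (carrier N) f h = compose (carrier N) f h'"
      by (rule inj_onD[OF inj]) (intro compose_hom[OF LN _ f] h)+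
    have "h = h'"
    proof (rule module_hom_ext[OF h])
      fix x assume x: "x \<in> carrier N"
      then have "f (h x) = f (h' x)" using fh by (metis compose_eq)
      then show "h x = h' x"
        using inj_f module_homsD(2)[OF h(1) x] module_homsD(2)[OF h(2) x] by (blast dest: inj_onD)
    qed
    then show "m = m'" using m_eq by simp
  qed
  moreover have "farr M A B f ` carrier (fobj M A) = kernel (fobj M B) (fobj M C) (farr M B C g)"
  proof (intro equalityI subsetI)
    fix m assume "m \<in> farr M A B f ` carrier (fobj M A)"
    then obtain k where k: "k \<in> carrier (fobj M A)" "m = farr M A B f k" by blast
    have "g (f x) = \<zero>\<^bsub>C\<^esub>" if "x \<in> carrier A" for x
      using exact that by blast
    then have "compose (carrier A) g f = (\<lambda>x\<in>carrier A. \<zero>\<^bsub>C\<^esub>)"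
      unfolding compose_def by (rule restrict_ext)
    then show "m \<in> kernel (fobj M B) (fobj M C) (farr M B C g)"
      using arr_comp[OF A B C f g k(1)] arr_zero[OF A C k(1)] arr_closed[OF A B f k(1)] k(2)
      by (simp add: kernel_def)
  next
    fix m assume "m \<in> kernel (fobj M B) (fobj M C) (farr M B C g)"
    then have m: "m \<in> carrier (fobj M B)" "farr M B C g m = \<one>\<^bsub>fobj M C\<^esub>"
      by (auto simp: kernel_def)
    obtain N s h where mono: "mono_element N s" and h: "h \<in> module_homs R N B"
      and m_eq: "m = farr M N B h s"
      using direct_limit_common_generator[OF lim B m(1) m(1)] by metis
    have N: "small_module R N" and s: "s \<in> carrier (fobj M N)"
      and inj: "inj_on (\<lambda>f. farr M N C f s) (module_homs R N C)"
      using mono C by (auto simp: mono_element_def)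
    have LN: "left_module R N" using N by (rule small_module_imp_left_module)
    interpret N: left_module R N by fact
    have "farr M N C (compose (carrier N) g h) s = farr M N C (\<lambda>x\<in>carrier N. \<zero>\<^bsub>C\<^esub>) s"
      using m(2) m_eq arr_comp[OF N B C h g s] arr_zero[OF N C s] by simp
    then have gh: "compose (carrier N) g h = (\<lambda>x\<in>carrier N. \<zero>\<^bsub>C\<^esub>)"
      by (rule inj_onD[OF inj]) (intro compose_hom[OF LN h g] zero_hom[OF LN LC])+
    define k where "k = (\<lambda>x\<in>carrier N. inv_into (carrier A) f (h x))"
    have k: "k x \<in> carrier A" "f (k x) = h x" if x: "x \<in> carrier N" for x
    proof -
      have "g (h x) = \<zero>\<^bsub>C\<^esub>" using fun_cong[OF gh, of x] x by (simp add: compose_def)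
      then have "h x \<in> f ` carrier A" using exact module_homsD(2)[OF h x] by blast
      then show "k x \<in> carrier A" "f (k x) = h x"
        using x by (simp_all add: k_def inv_into_into f_inv_into_f)
    qed
    have "k \<in> module_homs R N A"
    proof (rule module_homsI)
      show "k (x \<oplus>\<^bsub>N\<^esub> y) = k x \<oplus>\<^bsub>A\<^esub> k y" if "x \<in> carrier N" "y \<in> carrier N" for x y
        by (rule inj_onD[OF inj_f]) (simp_all add: that k module_homsD(3)[OF h] module_homsD(3)[OF f])
      show "k (a \<odot>\<^bsub>N\<^esub> x) = a \<odot>\<^bsub>A\<^esub> k x" if "a \<in> carrier R" "x \<in> carrier N" for a x
        by (rule inj_onD[OF inj_f]) (simp_all add: that k module_homsD(4)[OF h] module_homsD(4)[OF f])
    qed (use k in \<open>auto simp: k_def\<close>)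
    moreover have "compose (carrier N) f k = h"
      using k(2) module_homsD(1)[OF h] by (auto simp: compose_def extensional_def fun_eq_iff)
    ultimately have "m = farr M A B f (farr M N A k s)" "farr M N A k s \<in> carrier (fobj M A)"
      using arr_comp[OF N A B _ f s] arr_closed[OF N A _ s] m_eq by auto
    then show "m \<in> farr M A B f ` carrier (fobj M A)" by blast
  qed
  ultimately show "inj_on (farr M A B f) (carrier (fobj M A)) \<and>
      farr M A B f ` carrier (fobj M A) = kernel (fobj M B) (fobj M C) (farr M B C g)"
    by blast
qed

end

section \<open>The equivalence\<close>

theorem theorem4p3:
  fixes R :: "'r ring"
    and M :: "('r, 'u::universe, 'm) rfun"
    and L :: "'l set"
    and W :: "'l \<Rightarrow> ('r, 'u) module"
    and \<pi> :: "('r, 'u) module \<Rightarrow> ('l \<Rightarrow> 'u \<Rightarrow> 'u) \<Rightarrow> 'm"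
  assumes "ring R"
    and "R_functor R M"
    and "|L| <o |UNIV :: 'u set|"
    and "\<And>l. l \<in> L \<Longrightarrow> small_module R (W l)"
    and "R_epimorphism R (direct_sum L (\<lambda>l. module_scheme R (W l))) M \<pi>"
  shows "((left_exact R M \<and> Mittag_Leffler R M) \<longleftrightarrow>
          (\<forall>N \<eta>. small_module R N \<longrightarrow> R_morphism R (module_scheme R N) M \<eta> \<longrightarrow>
            (\<exists>S. submodule_scheme R M S \<and> factors_through R (module_scheme R N) M \<eta> S)))
       \<and> ((\<forall>N \<eta>. small_module R N \<longrightarrow> R_morphism R (module_scheme R N) M \<eta> \<longrightarrow>
            (\<exists>S. submodule_scheme R M S \<and> factors_through R (module_scheme R N) M \<eta> S)) \<longleftrightarrow>
          direct_limit_of_submodule_schemes R M)"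
proof -
  interpret module_functor R M
    using assms(1,2) by (rule module_functor.intro)
  have "covered_by_schemes \<longleftrightarrow> direct_limit_of_submodule_schemes R M"
    using covered_imp_direct_limit[OF _ assms(3-5)] direct_limit_imp_covered by blast
  moreover have "left_exact R M \<and> Mittag_Leffler R M \<longleftrightarrow> covered_by_schemes"
    using left_exact_Mittag_Leffler_imp_covered direct_limit_imp_left_exact
      direct_limit_imp_Mittag_Leffler calculation by blast
  ultimately show ?thesis
    unfolding factorization_iff_covered by blast
qed

end
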